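(* Let $n,p\ge 1$ and let $A_1,\dots,A_n\in\mathbb{S}_+(p)$. Let $F(X)=\sum_{i=1}^n \operatorname{dist}^2(A_i,X)$ for $X\in\mathbb{S}_+(p)$, and let $\hat X=\operatorname{arg\,min}_{X\in\mathbb{S}_+(p)}F(X)$ be the Karcher mean of $A_1,\dots,A_n$. Let $X_1\in\mathbb{S}_+(p)$ be arbitrary and define for $k\ge 1$ $$X_{k+1}=T(X_k)=f_2(X_k)^{1/2}\Big(f_2(X_k)^{1/2}f_1(X_k)f_2(X_k)^{1/2}\Big)^{-1/2}f_2(X_k)^{1/2}.$$ Then the sequence $\{X_k\}_{k\ge1}$ converges to $\hat X$, and $\{F(X_k)\}_{k\ge 1}$ converges asymptotically linearly to $F(\hat X)$, i.e. there exist $K\in\mathbb{N}$ and $q\in[0,1)$ such that $F(X_{k+1})-F(\hat X)\le q\,\big(F(X_k)-F(\hat X)\big)$ for all $k>K$.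
   Context: $\mathbb{S}_+(p)$ is the set of real symmetric positive definite $p\times p$ matrices. For a real symmetric matrix $X=U\operatorname{diag}(\lambda_1,\dots,\lambda_p)U^T$ ($U$ orthogonal) and a scalar function $g$ defined at the $\lambda_i$, $g(X)=U\operatorname{diag}(g(\lambda_1),\dots,g(\lambda_p))U^T$; this defines $X^{1/2}$, $X^{-1/2}$, $\log X$, $g_1(X)$, $g_2(X)$. $\|\cdot\|_F$ is the Frobenius norm, and $\operatorname{dist}(A,X)=\|\log(X^{-1/2}AX^{-1/2})\|_F$ for $A,X\in\mathbb{S}_+(p)$. It is known that $F$ has a unique minimizer $\hat X$ over $\mathbb{S}_+(p)$. For $x>0$, $$g_1(x)=\big(\sqrt{(\log x)^2+1}+\log x\big)x^{-1},\qquad g_2(x)=\big(\sqrt{(\log x)^2+1}-\log x\big)x,$$ and for $X\in\mathbb{S}_+(p)$, $$f_1(X)=\sum_{i=1}^n A_i^{-1/2}g_1\big(A_i^{-1/2}XA_i^{-1/2}\big)A_i^{-1/2},\qquad f_2(X)=\sum_{i=1}^n A_i^{1/2}g_2\big(A_i^{-1/2}XA_i^{-1/2}\big)A_i^{1/2}.$$ *)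

theory Defs
  imports "HOL-Analysis.Analysis"
begin

definition spd :: "(real ^ 'p ^ 'p) set" where
  "spd = {X. transpose X = X \<and> (\<forall>v. v \<noteq> 0 \<longrightarrow> v \<bullet> (X *v v) > 0)}"

definition diag :: "('p \<Rightarrow> real) \<Rightarrow> real ^ 'p ^ 'p" where
  "diag d = (\<chi> i j. if i = j then d i else 0)"

text \<open>
  The value of \<open>matfun g X\<close> does not depend on the spectral decomposition
  chosen, see \<open>matfun_eq\<close> below. It is meaningful for symmetric \<open>X\<close> only.
\<close>

definition matfun :: "(real \<Rightarrow> real) \<Rightarrow> real ^ 'p ^ 'p \<Rightarrow> real ^ 'p ^ 'p" where
  "matfun g X = (THE Y. \<exists>U d. orthogonal_matrix U \<and> X = U ** diag d ** transpose U \<and>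
                              Y = U ** diag (\<lambda>i. g (d i)) ** transpose U)"

lemma matrix_mult_diag_nth: "(W ** diag d) $ i $ j = W $ i $ j * d j"
  by (simp add: matrix_matrix_mult_def diag_def if_distrib[of "\<lambda>x. _ * x"] sum.delta cong: if_cong)

lemma diag_mult_matrix_nth: "(diag d ** W) $ i $ j = d i * W $ i $ j"
  by (simp add: matrix_matrix_mult_def diag_def if_distrib[of "\<lambda>x. x * _"] sum.delta cong: if_cong)

lemma spectral_decomposition_cong:
  fixes U V :: "real ^ 'p ^ 'p"
  assumes U: "orthogonal_matrix U" and V: "orthogonal_matrix V"
    and eq: "U ** diag d ** transpose U = V ** diag e ** transpose V"
  shows "U ** diag (\<lambda>i. g (d i)) ** transpose U = V ** diag (\<lambda>i. g (e i)) ** transpose V"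
proof -
  define W where "W = transpose V ** U"
  have UU: "transpose U ** U = mat 1" "U ** transpose U = mat 1"
    and VV: "transpose V ** V = mat 1" "V ** transpose V = mat 1"
    using U V by (auto simp: orthogonal_matrix_def)
  have "W ** diag d = transpose V ** (U ** diag d ** transpose U) ** U"
    by (simp add: W_def matrix_mul_assoc[symmetric] UU)
  also have "\<dots> = diag e ** W"
    by (simp add: W_def eq matrix_mul_assoc VV)
  finally have W: "W ** diag d = diag e ** W" .
  have Wij: "W $ i $ j * d j = e i * W $ i $ j" for i j
    using arg_cong[OF W, of "\<lambda>M. M $ i $ j"] by (simp only: matrix_mult_diag_nth diag_mult_matrix_nth)
  have "W $ i $ j * g (d j) = g (e i) * W $ i $ j" for i j
    using Wij[of i j] by (cases "W $ i $ j = 0") (auto simp: mult.commute)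
  then have "W ** diag (\<lambda>i. g (d i)) = diag (\<lambda>i. g (e i)) ** W"
    by (simp add: vec_eq_iff matrix_mult_diag_nth diag_mult_matrix_nth)
  then have "V ** (W ** diag (\<lambda>i. g (d i))) ** transpose U =
             V ** (diag (\<lambda>i. g (e i)) ** W) ** transpose U"
    by simp
  moreover have "V ** (W ** diag (\<lambda>i. g (d i))) ** transpose U = U ** diag (\<lambda>i. g (d i)) ** transpose U"
    by (simp add: W_def matrix_mul_assoc VV)
  moreover have "V ** (diag (\<lambda>i. g (e i)) ** W) ** transpose U = V ** diag (\<lambda>i. g (e i)) ** transpose V"
    by (simp add: W_def matrix_mul_assoc[symmetric] UU)
  ultimately show ?thesis by simp
qed

lemma matfun_eq:
  assumes "orthogonal_matrix U"
  shows "matfun g (U ** diag d ** transpose U) = U ** diag (\<lambda>i. g (d i)) ** transpose U"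
  unfolding matfun_def
proof (rule the_equality)
  show "\<exists>V e. orthogonal_matrix V \<and> U ** diag d ** transpose U = V ** diag e ** transpose V \<and>
          U ** diag (\<lambda>i. g (d i)) ** transpose U = V ** diag (\<lambda>i. g (e i)) ** transpose V"
    using assms by (intro exI[of _ U] exI[of _ d]) simp
qed (auto dest: spectral_decomposition_cong[OF assms, where g = g])

definition msqrt :: "real ^ 'p ^ 'p \<Rightarrow> real ^ 'p ^ 'p" where
  "msqrt = matfun sqrt"

definition minvsqrt :: "real ^ 'p ^ 'p \<Rightarrow> real ^ 'p ^ 'p" where
  "minvsqrt = matfun (\<lambda>x. 1 / sqrt x)"

definition mlog :: "real ^ 'p ^ 'p \<Rightarrow> real ^ 'p ^ 'p" where
  "mlog = matfun ln"

text \<open>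
  The norm of the type \<open>real ^ 'p ^ 'p\<close> is the Frobenius norm.
\<close>

lemma norm_eq_frobenius: "norm (X :: real ^ 'p ^ 'p) = sqrt (\<Sum>i\<in>UNIV. \<Sum>j\<in>UNIV. (X $ i $ j)\<^sup>2)"
  by (simp add: norm_vec_def L2_set_def sum_nonneg)

definition spd_dist :: "real ^ 'p ^ 'p \<Rightarrow> real ^ 'p ^ 'p \<Rightarrow> real" where
  "spd_dist A X = norm (mlog (minvsqrt X ** A ** minvsqrt X))"

definition F :: "nat \<Rightarrow> (nat \<Rightarrow> real ^ 'p ^ 'p) \<Rightarrow> real ^ 'p ^ 'p \<Rightarrow> real" where
  "F n A X = (\<Sum>i=1..n. (spd_dist (A i) X)\<^sup>2)"

text \<open>
  \<open>arg_min\<close> selects some minimizer; for positive definite \<open>A 1, \<dots>, A n\<close> and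
  \<open>n \<ge> 1\<close> the minimizer of \<open>F n A\<close> over \<open>spd\<close> exists and is unique.
\<close>

definition karcher_mean :: "nat \<Rightarrow> (nat \<Rightarrow> real ^ 'p ^ 'p) \<Rightarrow> real ^ 'p ^ 'p" where
  "karcher_mean n A = arg_min (F n A) (\<lambda>X. X \<in> spd)"

definition g1 :: "real \<Rightarrow> real" where
  "g1 x = (sqrt ((ln x)\<^sup>2 + 1) + ln x) * inverse x"

definition g2 :: "real \<Rightarrow> real" where
  "g2 x = (sqrt ((ln x)\<^sup>2 + 1) - ln x) * x"

definition f1 :: "nat \<Rightarrow> (nat \<Rightarrow> real ^ 'p ^ 'p) \<Rightarrow> real ^ 'p ^ 'p \<Rightarrow> real ^ 'p ^ 'p" where
  "f1 n A X = (\<Sum>i=1..n. minvsqrt (A i) **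
                 matfun g1 (minvsqrt (A i) ** X ** minvsqrt (A i)) ** minvsqrt (A i))"

definition f2 :: "nat \<Rightarrow> (nat \<Rightarrow> real ^ 'p ^ 'p) \<Rightarrow> real ^ 'p ^ 'p \<Rightarrow> real ^ 'p ^ 'p" where
  "f2 n A X = (\<Sum>i=1..n. msqrt (A i) **
                 matfun g2 (minvsqrt (A i) ** X ** minvsqrt (A i)) ** msqrt (A i))"

definition T :: "nat \<Rightarrow> (nat \<Rightarrow> real ^ 'p ^ 'p) \<Rightarrow> real ^ 'p ^ 'p \<Rightarrow> real ^ 'p ^ 'p" where
  "T n A X = msqrt (f2 n A X) **
               minvsqrt (msqrt (f2 n A X) ** f1 n A X ** msqrt (f2 n A X)) **
             msqrt (f2 n A X)"

end

theory Submission
  imports Defs "HOL-Real_Asymp.Real_Asymp"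
begin

text \<open>
  Whitening by \<open>X\<close> turns \<open>A\<^sub>i\<close> into \<open>B\<^sub>i = X\<^sup>-\<^sup>1\<^sup>/\<^sup>2 A\<^sub>i X\<^sup>-\<^sup>1\<^sup>/\<^sup>2\<close>; let \<open>S = \<Sum>\<^sub>i log B\<^sub>i\<close>. Two estimates suffice.

  Strong convexity: \<open>F(Y) \<ge> F(X) - 2 \<langle>V, S\<rangle> + n \<parallel>V\<parallel>\<^sup>2\<close> with
  \<open>V = log (X\<^sup>-\<^sup>1\<^sup>/\<^sup>2 Y X\<^sup>-\<^sup>1\<^sup>/\<^sup>2)\<close>, because \<open>\<parallel>log Y - log A\<parallel> \<le> dist(A, Y)\<close>. Hence
  \<open>F(X) - min F \<le> \<parallel>S\<parallel>\<^sup>2 / n\<close>, and the minimizer, where \<open>S = 0\<close>, satisfies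
  \<open>F(Y) - min F \<ge> n \<parallel>V\<parallel>\<^sup>2\<close>.

  Descent: up to an additive constant, \<open>tr(f\<^sub>1(X) Y) + tr(f\<^sub>2(X) Y\<^sup>-\<^sup>1)\<close> majorizes \<open>F(Y)\<close> with equality at
  \<open>Y = X\<close>, and \<open>T(X)\<close> is its minimizer. Comparing with a short geodesic step in the direction \<open>S\<close> yields
  \<open>F(T(X)) \<le> F(X) - c \<parallel>S\<parallel>\<^sup>2\<close>, with \<open>c\<close> uniform on sublevel sets of \<open>F\<close>.

  Together these make \<open>F(X\<^sub>k) - min F\<close> decrease geometrically from the first step on.
\<close>

section \<open>Matrix algebra\<close>

lemma bounded_bilinear_matrix_mult:
  "bounded_bilinear ((**) :: real ^ 'n ^ 'm \<Rightarrow> real ^ 'k ^ 'n \<Rightarrow> real ^ 'k ^ 'm)"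
  unfolding bilinear_conv_bounded_bilinear[symmetric] bilinear_def
  by (auto intro!: linearI simp: vec_eq_iff matrix_matrix_mult_def sum.distrib algebra_simps sum_distrib_left)

interpretation matmul: bounded_bilinear "(**) :: real ^ 'n ^ 'm \<Rightarrow> real ^ 'k ^ 'n \<Rightarrow> real ^ 'k ^ 'm"
  by (rule bounded_bilinear_matrix_mult)

lemma transpose_add: "transpose (A + B) = transpose A + transpose (B :: real ^ 'n ^ 'm)"
  by (simp add: transpose_def vec_eq_iff)

lemma transpose_diff: "transpose (A - B) = transpose A - transpose (B :: real ^ 'n ^ 'm)"
  by (simp add: transpose_def vec_eq_iff)

lemma transpose_sum: "transpose (\<Sum>i\<in>I. f i) = (\<Sum>i\<in>I. transpose (f i :: real ^ 'n ^ 'm))"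
  by (simp add: transpose_def vec_eq_iff)

lemma transpose_diag [simp]: "transpose (diag d) = diag d"
  by (auto simp: transpose_def diag_def vec_eq_iff)

lemma inner_matrix_eq_sum: "(A :: real ^ 'n ^ 'm) \<bullet> B = (\<Sum>i\<in>UNIV. \<Sum>j\<in>UNIV. A $ i $ j * B $ i $ j)"
  by (simp add: inner_vec_def)

lemma inner_matrix_mult_left:
  fixes A :: "real ^ 'n ^ 'm" and B :: "real ^ 'k ^ 'n"
  shows "(A ** B) \<bullet> C = B \<bullet> (transpose A ** C)"
proof -
  have "(A ** B) \<bullet> C = (\<Sum>i\<in>UNIV. \<Sum>j\<in>UNIV. \<Sum>k\<in>UNIV. A $ i $ k * B $ k $ j * C $ i $ j)"
    by (simp add: inner_matrix_eq_sum matrix_matrix_mult_def sum_distrib_right)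
  also have "\<dots> = (\<Sum>i\<in>UNIV. \<Sum>k\<in>UNIV. \<Sum>j\<in>UNIV. A $ i $ k * B $ k $ j * C $ i $ j)"
    by (intro sum.cong refl sum.swap)
  also have "\<dots> = (\<Sum>k\<in>UNIV. \<Sum>i\<in>UNIV. \<Sum>j\<in>UNIV. A $ i $ k * B $ k $ j * C $ i $ j)"
    by (rule sum.swap)
  also have "\<dots> = (\<Sum>k\<in>UNIV. \<Sum>j\<in>UNIV. \<Sum>i\<in>UNIV. A $ i $ k * B $ k $ j * C $ i $ j)"
    by (intro sum.cong refl sum.swap)
  also have "\<dots> = B \<bullet> (transpose A ** C)"
    by (simp add: inner_matrix_eq_sum matrix_matrix_mult_def transpose_def sum_distrib_left ac_simps)
  finally show ?thesis .
qed

lemma inner_transpose: "transpose (A :: real ^ 'n ^ 'm) \<bullet> transpose B = A \<bullet> B"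
  unfolding inner_matrix_eq_sum transpose_def by (simp, rule sum.swap)

lemma inner_matrix_mult_right:
  fixes A :: "real ^ 'n ^ 'm" and B :: "real ^ 'k ^ 'n"
  shows "(A ** B) \<bullet> C = A \<bullet> (C ** transpose B)"
proof -
  have "(A ** B) \<bullet> C = (transpose B ** transpose A) \<bullet> transpose C"
    by (simp add: inner_transpose flip: matrix_transpose_mul)
  also have "\<dots> = transpose A \<bullet> transpose (C ** transpose B)"
    by (simp add: inner_matrix_mult_left matrix_transpose_mul)
  finally show ?thesis by (simp add: inner_transpose)
qed

lemma inner_matrix_vector_symmetric:
  fixes X :: "real ^ 'p ^ 'p"
  assumes "transpose X = X"
  shows "(X *v u) \<bullet> v = u \<bullet> (X *v v)"
  by (metis assms dot_lmul_matrix transpose_matrix_vector)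

section \<open>The spectral theorem\<close>

text \<open>A maximizer of the Rayleigh quotient over the compact unit sphere of \<open>S\<close> is
  an eigenvector: invariance keeps the residual \<open>w\<close> in \<open>S\<close>, and moving
  along a nonzero residual would raise the quotient.\<close>

lemma symmetric_eigenvector_in_subspace:
  fixes X :: "real ^ 'p ^ 'p"
  assumes sym: "transpose X = X" and S: "subspace S" "\<And>v. v \<in> S \<Longrightarrow> X *v v \<in> S"
    and ne: "z \<in> S" "z \<noteq> 0"
  obtains v c where "v \<in> S" "norm v = 1" "X *v v = c *\<^sub>R v"
proof -
  define K where "K = S \<inter> sphere 0 1"
  have "compact K" unfolding K_def
    by (simp add: S closed_subspace closed_Int_compact)
  moreover have "z /\<^sub>R norm z \<in> K"
    using ne S by (simp add: K_def subspace_scale)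
  moreover have cont: "continuous_on K (\<lambda>u. u \<bullet> (X *v u))"
    by (intro continuous_intros linear_continuous_on matrix_vector_mul_bounded_linear)
  ultimately obtain v where v: "v \<in> K" and max: "\<And>u. u \<in> K \<Longrightarrow> u \<bullet> (X *v u) \<le> v \<bullet> (X *v v)"
    using continuous_attains_sup[of K "\<lambda>u. u \<bullet> (X *v u)"] cont by blast
  define c where "c = v \<bullet> (X *v v)"
  have nv: "norm v = 1" "v \<bullet> v = 1" and vS: "v \<in> S"
    using v by (auto simp: K_def dot_square_norm)
  have max': "u \<bullet> (X *v u) \<le> c * (u \<bullet> u)" if "u \<in> S" for u
  proof (cases "u = 0")
    case False
    then have "u /\<^sub>R norm u \<in> K" using that S by (simp add: K_def subspace_scale)
    from max[OF this] False show ?thesis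
      by (simp add: c_def matrix_vector_mult_scaleR dot_square_norm power2_eq_square field_simps)
  qed simp
  define w where "w = X *v v - c *\<^sub>R v"
  have wS: "w \<in> S" unfolding w_def using S vS by (intro subspace_diff subspace_scale) auto
  have wv: "w \<bullet> v = 0" using nv
    by (simp add: w_def inner_diff_left inner_commute[of "X *v v" v] c_def)
  have Xv: "X *v v = w + c *\<^sub>R v" by (simp add: w_def)
  have wXv: "w \<bullet> (X *v v) = w \<bullet> w" unfolding Xv by (simp add: inner_add_right wv)
  have vXw: "v \<bullet> (X *v w) = w \<bullet> w"
    using wXv inner_matrix_vector_symmetric[OF sym, of v w] by (simp add: inner_commute)
  define a where "a = w \<bullet> w"
  define b where "b = c * (w \<bullet> w) - w \<bullet> (X *v w)"
  \<comment> \<open>Maximality is tested at \<open>v + t w\<close>: the first-order gain is bounded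
    by a second-order term for every \<open>t\<close>, so \<open>a\<close> has to vanish.\<close>
  have ineq: "2 * t * a \<le> t\<^sup>2 * b" for t
  proof -
    have "v + t *\<^sub>R w \<in> S" using S vS wS by (intro subspace_add subspace_scale)
    from max'[OF this]
    have "(v + t *\<^sub>R w) \<bullet> (X *v v + t *\<^sub>R (X *v w)) \<le> c * ((v + t *\<^sub>R w) \<bullet> (v + t *\<^sub>R w))"
      by (simp only: matrix_vector_right_distrib matrix_vector_mult_scaleR)
    moreover have "(v + t *\<^sub>R w) \<bullet> (X *v v + t *\<^sub>R (X *v w)) = c + 2 * t * a + t\<^sup>2 * (w \<bullet> (X *v w))"
      unfolding inner_add_left inner_add_right inner_scaleR_left inner_scaleR_right vXw wXv a_def c_def
      by (simp add: power2_eq_square algebra_simps)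
    moreover have "(v + t *\<^sub>R w) \<bullet> (v + t *\<^sub>R w) = 1 + t\<^sup>2 * a"
      unfolding inner_add_left inner_add_right inner_scaleR_left inner_scaleR_right wv nv a_def inner_commute[of v w]
      by (simp add: power2_eq_square)
    ultimately have "c + 2 * t * a + t\<^sup>2 * (w \<bullet> (X *v w)) \<le> c * (1 + t\<^sup>2 * a)"
      by (simp only:)
    then show ?thesis by (simp add: b_def flip: a_def) (simp add: algebra_simps)
  qed
  have "a = 0"
  proof (rule ccontr)
    assume "a \<noteq> 0"
    then have a: "a > 0" by (simp add: a_def)
    \<comment> \<open>Small enough that \<open>t * b <= a\<close>; the \<open>+ 1\<close> covers
      \<open>b = 0\<close>.\<close>
    define t where "t = a / (\<bar>b\<bar> + 1)"
    have t: "t > 0" using a by (simp add: t_def)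
    have "2 * a \<le> t * b" using ineq[of t] t by (simp add: power2_eq_square)
    also have "\<dots> \<le> t * \<bar>b\<bar>" using t by simp
    also have "\<dots> \<le> a" using a by (simp add: t_def field_simps)
    finally show False using a by simp
  qed
  then have "X *v v = c *\<^sub>R v" by (simp add: a_def w_def)
  with vS nv show ?thesis by (intro that) auto
qed

text \<open>By symmetry the orthogonal complement of the eigenvectors found so far is invariant, and
  it is nonzero while they are fewer than the dimension, so it contains one more.\<close>

lemma symmetric_orthonormal_eigenvectors:
  fixes X :: "real ^ 'p ^ 'p"
  assumes sym: "transpose X = X"
  shows "k \<le> CARD('p) \<Longrightarrow> \<exists>B. finite B \<and> card B = k \<and> pairwise orthogonal B \<and>
           (\<forall>b\<in>B. norm b = 1 \<and> (\<exists>c. X *v b = c *\<^sub>R b))"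
proof (induction k)
  case (Suc k)
  then obtain B where B: "finite B" "card B = k" "pairwise orthogonal B"
    "\<And>b. b \<in> B \<Longrightarrow> norm b = 1 \<and> (\<exists>c. X *v b = c *\<^sub>R b)" by auto
  define S where "S = {v. \<forall>b\<in>B. orthogonal b v}"
  have "dim B < DIM(real ^ 'p)"
    using dim_le_card'[OF B(1)] B(2) Suc.prems by simp
  from orthogonal_to_subspace_exists[OF this] obtain z where
    z: "z \<noteq> 0" "\<And>y. y \<in> span B \<Longrightarrow> orthogonal z y" by blast
  then have "z \<in> S" by (auto simp: S_def span_base orthogonal_commute)
  note z(1) this
  moreover have "subspace S"
    unfolding S_def by (rule subspaceI) (auto simp: orthogonal_clauses)
  moreover have "X *v v \<in> S" if "v \<in> S" for v
    unfolding S_def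
  proof safe
    fix b assume b: "b \<in> B"
    then obtain c where "X *v b = c *\<^sub>R b" using B by blast
    then show "orthogonal b (X *v v)"
      using that b inner_matrix_vector_symmetric[OF sym, of b v] by (simp add: S_def orthogonal_def)
  qed
  ultimately obtain v c where v: "v \<in> S" "norm v = 1" "X *v v = c *\<^sub>R v"
    using symmetric_eigenvector_in_subspace[OF sym] by metis
  have "v \<notin> B"
    using v by (auto simp: S_def orthogonal_def)
  then show ?case using B v
    by (intro exI[of _ "insert v B"]) (auto simp: S_def pairwise_insert orthogonal_commute)
qed (auto intro!: exI[of _ "{}"])

theorem spectral_decomposition:
  fixes X :: "real ^ 'p ^ 'p"
  assumes sym: "transpose X = X"
  obtains U d where "orthogonal_matrix U" "X = U ** diag d ** transpose U"
proof -
  obtain B :: "(real ^ 'p) set" where B: "finite B" "card B = CARD('p)" "pairwise orthogonal B"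
    "\<And>b. b \<in> B \<Longrightarrow> norm b = 1" "\<And>b. b \<in> B \<Longrightarrow> \<exists>c. X *v b = c *\<^sub>R b"
    using symmetric_orthonormal_eigenvectors[OF sym order_refl] by blast
  obtain u where u: "bij_betw u (UNIV :: 'p set) B"
    using finite_same_card_bij[of "UNIV :: 'p set" B] B by auto
  then have uB: "u i \<in> B" for i by (auto simp: bij_betw_def)
  obtain d where d: "X *v u i = d i *\<^sub>R u i" for i
    using B(5)[OF uB] by metis
  define U where "U = (\<chi> i j. u j $ i)"
  have col: "column j U = u j" for j by (simp add: U_def column_def vec_eq_iff)
  have U: "orthogonal_matrix U"
    unfolding orthogonal_matrix_orthonormal_columns col
  proof (intro conjI allI impI)
    fix i j :: 'p assume "i \<noteq> j"
    then have "u i \<noteq> u j" using u by (auto simp: bij_betw_def inj_def)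
    then show "orthogonal (u i) (u j)" using B(3) uB by (auto simp: pairwise_def)
  qed (use uB B(4) in auto)
  have "X ** U = U ** diag d"
  proof (simp add: vec_eq_iff matrix_mult_diag_nth, safe)
    fix i j
    have "(X ** U) $ i $ j = (X *v u j) $ i"
      by (simp add: matrix_matrix_mult_def matrix_vector_mult_def U_def)
    then show "(X ** U) $ i $ j = U $ i $ j * d j" by (simp add: d U_def)
  qed
  then have "X = U ** diag d ** transpose U"
    by (metis U matrix_mul_assoc matrix_mul_rid orthogonal_matrix_def)
  with U that show ?thesis by blast
qed

section \<open>Functional calculus\<close>

lemma spdD:
  assumes "X \<in> spd"
  shows "transpose X = X" "v \<noteq> 0 \<Longrightarrow> 0 < v \<bullet> (X *v v)"
  using assms by (auto simp: spd_def)

lemma diag_nth: "diag d $ i $ j = (if i = j then d i else 0)"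
  by (simp add: diag_def)

lemma diag_mult_diag: "diag a ** diag b = diag (\<lambda>i. a i * b i)"
  by (simp add: vec_eq_iff matrix_mult_diag_nth diag_nth)

lemma diag_const: "diag (\<lambda>_. c) = c *\<^sub>R mat 1"
  by (simp add: vec_eq_iff diag_nth mat_def)

lemma conjugate_mult:
  fixes U :: "real ^ 'p ^ 'p"
  assumes "orthogonal_matrix U"
  shows "(U ** M ** transpose U) ** (U ** N ** transpose U) = U ** (M ** N) ** transpose U"
proof -
  have "(U ** M ** transpose U) ** (U ** N ** transpose U) = U ** M ** (transpose U ** U) ** N ** transpose U"
    by (simp only: matrix_mul_assoc)
  also have "\<dots> = U ** M ** N ** transpose U"
    using assms by (simp add: orthogonal_matrix_def)
  finally show ?thesis by (simp only: matrix_mul_assoc)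
qed

lemma matfun_symmetric:
  assumes "transpose X = X"
  shows "transpose (matfun f X) = matfun f X"
  by (rule spectral_decomposition[OF assms]) (simp add: matfun_eq matrix_transpose_mul matrix_mul_assoc)

lemma matfun_mult:
  assumes "transpose X = X"
  shows "matfun f X ** matfun g X = matfun (\<lambda>x. f x * g x) X"
  by (rule spectral_decomposition[OF assms]) (simp add: matfun_eq conjugate_mult diag_mult_diag)

lemma matfun_id:
  assumes "transpose X = X"
  shows "matfun (\<lambda>x. x) X = X"
  by (rule spectral_decomposition[OF assms]) (simp add: matfun_eq)

lemma matfun_const:
  assumes "transpose X = X"
  shows "matfun (\<lambda>_. c) X = c *\<^sub>R mat 1"
  by (rule spectral_decomposition[OF assms])
    (simp add: matfun_eq diag_const matrix_scalar_ac flip: scalar_matrix_assoc, simp add: orthogonal_matrix_def)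

lemma matfun_comp:
  assumes "transpose X = X"
  shows "matfun f (matfun g X) = matfun (\<lambda>x. f (g x)) X"
  by (rule spectral_decomposition[OF assms]) (simp add: matfun_eq)

lemma matfun_zero: "matfun f 0 = f 0 *\<^sub>R mat 1"
proof -
  have "(0 :: real ^ 'p ^ 'p) = mat 1 ** diag (\<lambda>_. 0) ** transpose (mat 1)"
    by (simp add: vec_eq_iff diag_nth)
  from arg_cong[OF this, of "matfun f"]
  have "matfun f (0 :: real ^ 'p ^ 'p) = mat 1 ** diag (\<lambda>_. f 0) ** transpose (mat 1)"
    by (rule trans[OF _ matfun_eq[OF orthogonal_matrix_id]])
  then show ?thesis by (simp add: diag_const)
qed

lemma diag_mult_vector_nth: "(diag d *v v) $ i = d i * v $ i"
  by (simp add: matrix_vector_mult_def diag_def if_distrib[of "\<lambda>x. x * _"] cong: if_cong)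

lemma inner_conjugate_diag:
  "v \<bullet> ((U ** diag d ** transpose U) *v v) = (\<Sum>i\<in>UNIV. d i * ((transpose U *v v) $ i)\<^sup>2)"
proof -
  have "v \<bullet> ((U ** diag d ** transpose U) *v v) = v \<bullet> (U *v (diag d *v (transpose U *v v)))"
    by (simp only: matrix_vector_mul_assoc matrix_mul_assoc)
  also have "\<dots> = (transpose U *v v) \<bullet> (diag d *v (transpose U *v v))"
    by (simp add: dot_lmul_matrix)
  also have "\<dots> = (\<Sum>i\<in>UNIV. d i * ((transpose U *v v) $ i)\<^sup>2)"
    unfolding inner_vec_def
    by (rule sum.cong) (simp_all add: diag_mult_vector_nth power2_eq_square)
  finally show ?thesis .
qed

lemma conjugate_diag_in_spd_iff:
  fixes U :: "real ^ 'p ^ 'p"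
  assumes U: "orthogonal_matrix U"
  shows "U ** diag d ** transpose U \<in> spd \<longleftrightarrow> (\<forall>i. d i > 0)"
proof safe
  fix i assume X: "U ** diag d ** transpose U \<in> spd"
  \<comment> \<open>Testing the quadratic form on column \<open>i\<close> of \<open>U\<close>
    isolates \<open>d i\<close>.\<close>
  have Uv: "transpose U *v (U *v axis i 1) = axis i 1"
    using U by (simp add: matrix_vector_mul_assoc orthogonal_matrix_def del: transpose_matrix_vector)
  then have "U *v axis i 1 \<noteq> 0" by (metis axis_eq_0_iff matrix_vector_mult_0_right zero_neq_one)
  from spdD(2)[OF X this] show "d i > 0"
    unfolding inner_conjugate_diag Uv by (simp add: axis_def if_distrib[of "\<lambda>x. x^2"] if_distrib[of "\<lambda>x. _ * x"] cong: if_cong)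
next
  assume d: "\<forall>i. d i > 0"
  show "U ** diag d ** transpose U \<in> spd"
    unfolding spd_def
  proof (intro CollectI conjI allI impI)
    show "transpose (U ** diag d ** transpose U) = U ** diag d ** transpose U"
      by (simp add: matrix_transpose_mul matrix_mul_assoc)
    fix v :: "real ^ 'p" assume v: "v \<noteq> 0"
    have "U *v (transpose U *v v) = v"
      using U by (simp add: matrix_vector_mul_assoc orthogonal_matrix_def del: transpose_matrix_vector)
    then have "transpose U *v v \<noteq> 0" using v by auto
    then obtain i where "(transpose U *v v) $ i \<noteq> 0"
      by (auto simp: vec_eq_iff simp del: transpose_matrix_vector)
    then show "0 < v \<bullet> ((U ** diag d ** transpose U) *v v)"
      unfolding inner_conjugate_diag using d
      by (intro sum_pos2[of _ i]) (auto simp: less_imp_le simp del: transpose_matrix_vector)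
  qed
qed

lemma matfun_cong:
  assumes X: "X \<in> spd" and eq: "\<And>x. x > 0 \<Longrightarrow> f x = g x"
  shows "matfun f X = matfun g X"
proof -
  obtain U d where U: "orthogonal_matrix U" "X = U ** diag d ** transpose U"
    using spectral_decomposition spdD(1)[OF X] by metis
  then have "d i > 0" for i using X by (simp add: conjugate_diag_in_spd_iff)
  then show ?thesis using U by (simp add: matfun_eq eq)
qed

lemma matfun_in_spd:
  assumes X: "X \<in> spd" and pos: "\<And>x. x > 0 \<Longrightarrow> f x > 0"
  shows "matfun f X \<in> spd"
proof -
  obtain U d where U: "orthogonal_matrix U" "X = U ** diag d ** transpose U"
    using spectral_decomposition spdD(1)[OF X] by metis
  then have "d i > 0" for i using X by (simp add: conjugate_diag_in_spd_iff)
  then show ?thesis using U by (simp add: matfun_eq pos conjugate_diag_in_spd_iff)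
qed

lemma matfun_symmetric_in_spd:
  assumes X: "transpose X = X" and pos: "\<And>x. f x > 0"
  shows "matfun f X \<in> spd"
  by (rule spectral_decomposition[OF X]) (simp add: matfun_eq pos conjugate_diag_in_spd_iff)

text \<open>In eigenbases of \<open>M\<close> and \<open>N\<close>, the relation says that an entry
  of \<open>W\<close> can be nonzero only where the two eigenvalues agree; there \<open>f\<close>
  may be applied to both.\<close>

lemma matfun_intertwine:
  fixes M N P :: "real ^ 'p ^ 'p"
  assumes M: "transpose M = M" and N: "transpose N = N" and MP: "M ** P = P ** N"
  shows "matfun f M ** P = P ** matfun f N"
proof -
  obtain U d where U: "orthogonal_matrix U" and Md: "M = U ** diag d ** transpose U"
    using spectral_decomposition[OF M] .
  obtain V e where V: "orthogonal_matrix V" and Ne: "N = V ** diag e ** transpose V"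
    using spectral_decomposition[OF N] .
  have UU: "transpose U ** U = mat 1" "U ** transpose U = mat 1"
    and VV: "transpose V ** V = mat 1" "V ** transpose V = mat 1"
    using U V by (auto simp: orthogonal_matrix_def)
  define W where "W = transpose U ** P ** V"
  have P: "P = U ** W ** transpose V"
  proof -
    have "U ** W ** transpose V = (U ** transpose U) ** P ** (V ** transpose V)"
      by (simp only: W_def matrix_mul_assoc)
    then show ?thesis by (simp add: UU VV)
  qed
  have 1: "U ** diag a ** transpose U ** P = U ** (diag a ** W) ** transpose V" for a
  proof -
    have "U ** diag a ** transpose U ** P = U ** diag a ** (transpose U ** U) ** W ** transpose V"
      by (simp only: P matrix_mul_assoc)
    then show ?thesis by (simp add: UU matrix_mul_assoc)
  qed
  have 2: "P ** (V ** diag a ** transpose V) = U ** (W ** diag a) ** transpose V" for a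
  proof -
    have "P ** (V ** diag a ** transpose V) = U ** W ** (transpose V ** V) ** diag a ** transpose V"
      by (simp only: P matrix_mul_assoc)
    then show ?thesis by (simp add: VV matrix_mul_assoc)
  qed
  have "diag d ** W = W ** diag e"
  proof -
    have "transpose U ** (U ** (diag d ** W) ** transpose V) ** V = transpose U ** (U ** (W ** diag e) ** transpose V) ** V"
      using MP unfolding Md Ne 1 2 by simp
    then have "(transpose U ** U) ** (diag d ** W) ** (transpose V ** V) = (transpose U ** U) ** (W ** diag e) ** (transpose V ** V)"
      by (simp only: matrix_mul_assoc)
    then show ?thesis by (simp add: UU VV)
  qed
  then have W: "d i * W $ i $ j = W $ i $ j * e j" for i j
    by (metis matrix_mult_diag_nth diag_mult_matrix_nth)
  have "f (d i) * W $ i $ j = W $ i $ j * f (e j)" for i j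
    using W[of i j] by (cases "W $ i $ j = 0") (auto simp: mult.commute)
  then have "diag (\<lambda>i. f (d i)) ** W = W ** diag (\<lambda>i. f (e i))"
    by (simp add: vec_eq_iff matrix_mult_diag_nth diag_mult_matrix_nth)
  then show ?thesis by (simp add: Md Ne matfun_eq U V 1 2)
qed

section \<open>Joint spectra of two symmetric matrices\<close>

text \<open>
  Inequalities between traces of products of functions of two symmetric matrices thereby reduce to
  scalar inequalities between pairs of eigenvalues. The weights are the squared entries of the
  orthogonal matrix relating the two eigenbases.
\<close>

definition joint_spectrum ::
  "real ^ 'p ^ 'p \<Rightarrow> real ^ 'p ^ 'p \<Rightarrow> ('p \<Rightarrow> 'p \<Rightarrow> real) \<Rightarrow> ('p \<Rightarrow> real) \<Rightarrow> ('p \<Rightarrow> real) \<Rightarrow> bool" where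
  "joint_spectrum X Y w x y \<longleftrightarrow> (\<forall>i j. w i j \<ge> 0) \<and> (\<forall>i. (\<Sum>j\<in>UNIV. w i j) = 1) \<and> (\<forall>j. (\<Sum>i\<in>UNIV. w i j) = 1) \<and>
    (\<forall>f g. matfun f X \<bullet> matfun g Y = (\<Sum>i\<in>UNIV. \<Sum>j\<in>UNIV. w i j * (f (x i) * g (y j)))) \<and>
    (X \<in> spd \<longrightarrow> (\<forall>i. x i > 0)) \<and> (Y \<in> spd \<longrightarrow> (\<forall>j. y j > 0))"

lemma joint_spectrumD:
  assumes "joint_spectrum X Y w x y"
  shows "w i j \<ge> 0" "(\<Sum>j\<in>UNIV. w i j) = 1" "(\<Sum>i\<in>UNIV. w i j) = 1"
    "matfun f X \<bullet> matfun g Y = (\<Sum>i\<in>UNIV. \<Sum>j\<in>UNIV. w i j * (f (x i) * g (y j)))"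
    "X \<in> spd \<Longrightarrow> x i > 0" "Y \<in> spd \<Longrightarrow> y j > 0"
  using assms unfolding joint_spectrum_def by blast+

text \<open>Rows and columns of the orthogonal matrix \<open>W\<close> have norm 1, so its squared
  entries are doubly stochastic weights. The decomposition of \<open>Y\<close> is prescribed so that
  \<open>y\<close> can stay fixed while \<open>X\<close> varies, as the continuity proof
  requires.\<close>

lemma joint_spectrum_of_decomposition:
  fixes X Y :: "real ^ 'p ^ 'p"
  assumes X: "transpose X = X" and V: "orthogonal_matrix V" and Yy: "Y = V ** diag y ** transpose V"
  obtains w x where "joint_spectrum X Y w x y"
proof -
  obtain U x where U: "orthogonal_matrix U" and Xx: "X = U ** diag x ** transpose U"
    using spectral_decomposition[OF X] .
  define W where "W = transpose U ** V"
  have W: "orthogonal_matrix W" unfolding W_def using U V by (intro orthogonal_matrix_mul) auto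
  have "(U ** diag a ** transpose U) \<bullet> (V ** diag b ** transpose V) = (\<Sum>i\<in>UNIV. \<Sum>j\<in>UNIV. (W $ i $ j)\<^sup>2 * (a i * b j))" for a b
  proof -
    have "(U ** diag a ** transpose U) \<bullet> (V ** diag b ** transpose V) = (diag a ** transpose U) \<bullet> (transpose U ** (V ** diag b ** transpose V))"
      by (simp add: inner_matrix_mult_left flip: matrix_mul_assoc)
    also have "\<dots> = diag a \<bullet> ((transpose U ** V) ** diag b ** (transpose V ** U))"
      by (simp add: inner_matrix_mult_right matrix_mul_assoc)
    also have "transpose V ** U = transpose W" by (simp add: W_def matrix_transpose_mul)
    also have "diag a \<bullet> ((transpose U ** V) ** diag b ** transpose W) = (\<Sum>i\<in>UNIV. a i * (W ** diag b ** transpose W) $ i $ i)"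
      unfolding W_def[symmetric] inner_matrix_eq_sum diag_nth
      by (simp add: if_distrib[of "\<lambda>x. x * _"] cong: if_cong)
    also have "\<dots> = (\<Sum>i\<in>UNIV. a i * (\<Sum>j\<in>UNIV. W $ i $ j * b j * W $ i $ j))"
      by (subst matrix_matrix_mult_def) (simp add: matrix_mult_diag_nth transpose_def)
    finally show ?thesis by (simp add: sum_distrib_left power2_eq_square ac_simps)
  qed
  then have tr: "matfun f X \<bullet> matfun g Y = (\<Sum>i\<in>UNIV. \<Sum>j\<in>UNIV. (W $ i $ j)\<^sup>2 * (f (x i) * g (y j)))" for f g
    unfolding Xx Yy by (simp add: matfun_eq U V)
  have "W ** transpose W = mat 1" "transpose W ** W = mat 1" using W by (auto simp: orthogonal_matrix_def)
  then have "(W ** transpose W) $ i $ i = 1" "(transpose W ** W) $ i $ i = 1" for i by (simp_all add: mat_def)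
  then have "(\<Sum>j\<in>UNIV. (W $ i $ j)\<^sup>2) = 1" "(\<Sum>j\<in>UNIV. (W $ j $ i)\<^sup>2) = 1" for i
    by (simp_all add: matrix_matrix_mult_def transpose_def power2_eq_square)
  then have "joint_spectrum X Y (\<lambda>i j. (W $ i $ j)\<^sup>2) x y"
    unfolding joint_spectrum_def using tr U V by (auto simp: Xx Yy conjugate_diag_in_spd_iff)
  with that show ?thesis .
qed

lemma joint_spectrum_exists:
  assumes X: "transpose X = X" and Y: "transpose Y = Y"
  obtains w x y where "joint_spectrum X Y w x y"
  by (rule spectral_decomposition[OF Y], rule joint_spectrum_of_decomposition[OF X]) (auto intro: that)

lemma inner_matfun_same:
  assumes "transpose X = X"
  shows "matfun f X \<bullet> matfun g X = matfun (\<lambda>x. f x * g x) X \<bullet> mat 1"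
  using inner_matrix_mult_right[of "mat 1" "matfun f X" "matfun g X"] assms
  by (simp add: matfun_symmetric matfun_mult inner_commute mult.commute)

lemma norm_matfun_power2:
  assumes "transpose X = X"
  shows "(norm (matfun f X))\<^sup>2 = matfun (\<lambda>x. (f x)\<^sup>2) X \<bullet> mat 1"
  unfolding power2_norm_eq_inner inner_matfun_same[OF assms] by (simp only: power2_eq_square)

lemma norm_matfun_diff_power2:
  assumes js: "joint_spectrum X Y w x y" and sX: "transpose X = X" and sY: "transpose Y = Y"
  shows "(norm (matfun f X - matfun f Y))\<^sup>2 = (\<Sum>i\<in>UNIV. \<Sum>j\<in>UNIV. w i j * (f (x i) - f (y j))\<^sup>2)"
proof -
  have "(norm (matfun f X - matfun f Y))\<^sup>2 = matfun f X \<bullet> matfun f X - 2 * (matfun f X \<bullet> matfun f Y) + matfun f Y \<bullet> matfun f Y"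
    by (simp add: power2_norm_eq_inner inner_diff_left inner_diff_right inner_commute)
  \<comment> \<open>Pairing with the constant function 1 of the other matrix turns every term into a
    sum over the same pairs of eigenvalues.\<close>
  also have "\<dots> = matfun (\<lambda>x. f x * f x) X \<bullet> matfun (\<lambda>_. 1) Y - 2 * (matfun f X \<bullet> matfun f Y)
       + matfun (\<lambda>_. 1) X \<bullet> matfun (\<lambda>x. f x * f x) Y"
    by (simp add: inner_matfun_same sX sY matfun_const inner_commute)
  also have "\<dots> = (\<Sum>i\<in>UNIV. \<Sum>j\<in>UNIV. w i j * (f (x i) - f (y j))\<^sup>2)"
    unfolding joint_spectrumD(4)[OF js]
    by (simp add: sum.distrib[symmetric] sum_subtractf[symmetric] sum_distrib_left power2_eq_square algebra_simps)
  finally show ?thesis .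
qed

lemma norm_matfun_eigenvalues:
  assumes js: "joint_spectrum X Y w x y" and X: "transpose X = X" and Y: "transpose Y = Y"
  shows "\<bar>f (x i)\<bar> \<le> norm (matfun f X)" "\<bar>f (y j)\<bar> \<le> norm (matfun f Y)"
proof -
  have "(f (x i))\<^sup>2 \<le> (\<Sum>i\<in>UNIV. (f (x i))\<^sup>2)"
    by (rule member_le_sum) auto
  also have "\<dots> = matfun (\<lambda>x. (f x)\<^sup>2) X \<bullet> matfun (\<lambda>_. 1) Y"
    unfolding joint_spectrumD(4)[OF js] by (simp add: joint_spectrumD(2)[OF js] flip: sum_distrib_right)
  finally have "(f (x i))\<^sup>2 \<le> (norm (matfun f X))\<^sup>2"
    by (simp add: norm_matfun_power2 X Y matfun_const)
  then show "\<bar>f (x i)\<bar> \<le> norm (matfun f X)"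
    using abs_le_square_iff[of "f (x i)" "norm (matfun f X)"] by simp
  have "(f (y j))\<^sup>2 \<le> (\<Sum>j\<in>UNIV. (f (y j))\<^sup>2)"
    by (rule member_le_sum) auto
  also have "\<dots> = matfun (\<lambda>_. 1) X \<bullet> matfun (\<lambda>x. (f x)\<^sup>2) Y"
    unfolding joint_spectrumD(4)[OF js]
    by (subst sum.swap) (simp add: joint_spectrumD(3)[OF js] flip: sum_distrib_right)
  finally have "(f (y j))\<^sup>2 \<le> (norm (matfun f Y))\<^sup>2"
    by (simp add: norm_matfun_power2 X Y matfun_const inner_commute)
  then show "\<bar>f (y j)\<bar> \<le> norm (matfun f Y)"
    using abs_le_square_iff[of "f (y j)" "norm (matfun f Y)"] by simp
qed

section \<open>Continuity of the functional calculus\<close>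

text \<open>The squared distance of the values is a weighted sum of
  \<open>(f (x i) - f (y j))^2\<close>. Pairs of close eigenvalues contribute little by continuity
  of \<open>f\<close>; distant pairs carry little weight, because the same weights applied to
  \<open>(x i - y j)^2\<close> give the squared norm of \<open>X - X0\<close>.\<close>

lemma continuous_matfun:
  fixes X0 :: "real ^ 'p ^ 'p"
  assumes X0: "transpose X0 = X0" and cont: "\<And>x. (X0 \<in> spd \<Longrightarrow> x > 0) \<Longrightarrow> isCont f x"
  shows "continuous (at X0 within {X. transpose X = X}) (matfun f)"
proof -
  obtain V y where V: "orthogonal_matrix V" and Y: "X0 = V ** diag y ** transpose V"
    using spectral_decomposition[OF X0] .
  have conty: "isCont f (y j)" for j
    by (rule cont) (use V Y in \<open>auto simp: conjugate_diag_in_spd_iff\<close>)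
  show ?thesis unfolding continuous_within_eps_delta
  proof (intro allI impI)
    fix e :: real assume e: "e > 0"
    \<comment> \<open>The weights add up to \<open>CARD('p)\<close>, so errors below
      \<open>a\<close> contribute at most \<open>(e/2)^2\<close>.\<close>
    define a where "a = e / (2 * sqrt CARD('p))"
    have a: "a > 0" using e by (simp add: a_def)
    have "\<exists>d>0. \<forall>x. \<bar>x - y j\<bar> < d \<longrightarrow> \<bar>f x - f (y j)\<bar> < a" for j
      using conty[of j] a unfolding continuous_at_eps_delta by (auto simp: dist_real_def)
    then obtain D where D: "\<And>j. D j > 0" "\<And>j x. \<bar>x - y j\<bar> < D j \<Longrightarrow> \<bar>f x - f (y j)\<bar> < a"
      by metis
    define d where "d = Min (range D)"
    have d: "d > 0" "\<And>j. d \<le> D j" using D(1) by (auto simp: d_def)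
    \<comment> \<open>Bounds \<open>f (x i) - f (y j)\<close> for any pair, by passing through some
      \<open>y k\<close> close to \<open>x i\<close>.\<close>
    define C where "C = a + 2 * (\<Sum>j\<in>UNIV. \<bar>f (y j)\<bar>)"
    have C: "C > 0" unfolding C_def using a by (intro add_pos_nonneg) (auto intro: sum_nonneg)
    have Cy: "\<bar>f (y j)\<bar> \<le> (\<Sum>j\<in>UNIV. \<bar>f (y j)\<bar>)" for j by (rule member_le_sum) auto
    \<comment> \<open>The first term puts each \<open>x i\<close> within \<open>d\<close> of some
      \<open>y j\<close>; the second limits the contribution of distant pairs to
      \<open>(e/2)^2\<close>.\<close>
    define t where "t = min d (d * e / (2 * C))"
    have t: "t > 0" using d C e by (simp add: t_def)
    show "\<exists>t>0. \<forall>X\<in>{X. transpose X = X}. dist X X0 < t \<longrightarrow> dist (matfun f X) (matfun f X0) < e"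
    proof (intro exI[of _ t] conjI t ballI impI)
      fix X :: "real ^ 'p ^ 'p" assume "X \<in> {X. transpose X = X}" and Xt: "dist X X0 < t"
      then have X: "transpose X = X" by simp
      obtain w x where js: "joint_spectrum X X0 w x y"
        using joint_spectrum_of_decomposition[OF X V Y] .
      note w = joint_spectrumD(1)[OF js] and row = joint_spectrumD(2)[OF js]
      have nX: "(norm (X - X0))\<^sup>2 = (\<Sum>i\<in>UNIV. \<Sum>j\<in>UNIV. w i j * (x i - y j)\<^sup>2)"
        using norm_matfun_diff_power2[OF js X X0, of "\<lambda>x. x"] by (simp add: matfun_id X X0)
      \<comment> \<open>Otherwise row \<open>i\<close> alone, whose weights sum to 1, would
        contribute at least \<open>d^2\<close> to the squared norm of \<open>X - X0\<close>.\<close>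
      have near: "\<exists>j. \<bar>x i - y j\<bar> < d" for i
      proof (rule ccontr)
        assume "\<not> ?thesis"
        then have far: "\<bar>d\<bar> \<le> \<bar>x i - y j\<bar>" for j using d by (auto simp: not_less)
        have "d\<^sup>2 = (\<Sum>j\<in>UNIV. w i j * d\<^sup>2)" by (simp add: row flip: sum_distrib_right)
        also have "\<dots> \<le> (\<Sum>j\<in>UNIV. w i j * (x i - y j)\<^sup>2)"
          by (intro sum_mono mult_left_mono w) (use far in \<open>simp add: abs_le_square_iff\<close>)
        also have "\<dots> \<le> (norm (X - X0))\<^sup>2" unfolding nX
          by (rule member_le_sum[of i UNIV "\<lambda>i. \<Sum>j\<in>UNIV. w i j * (x i - y j)\<^sup>2"]) (auto intro!: sum_nonneg mult_nonneg_nonneg w)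
        finally have "d \<le> norm (X - X0)" by (rule power2_le_imp_le) simp
        with Xt show False by (simp add: t_def dist_norm)
      qed
      have bound: "(f (x i) - f (y j))\<^sup>2 \<le> a\<^sup>2 + (C / d)\<^sup>2 * (x i - y j)\<^sup>2" for i j
      proof (cases "\<bar>x i - y j\<bar> < d")
        case True
        then have "\<bar>f (x i) - f (y j)\<bar> < a" using D(2) d(2)[of j] by fastforce
        then have "(f (x i) - f (y j))\<^sup>2 \<le> a\<^sup>2" by (simp flip: abs_le_square_iff)
        then show ?thesis by (simp add: add_increasing2)
      next
        case False
        obtain k where "\<bar>x i - y k\<bar> < d" using near by blast
        then have "\<bar>f (x i) - f (y k)\<bar> < a" using D(2) d(2)[of k] by fastforce
        then have "\<bar>f (x i) - f (y j)\<bar> \<le> C"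
          using Cy[of k] Cy[of j] by (simp add: C_def)
        also have "C = C / d * d" using d by simp
        also have "\<dots> \<le> C / d * \<bar>x i - y j\<bar>" using False C d by (intro mult_left_mono) auto
        finally have "\<bar>f (x i) - f (y j)\<bar>\<^sup>2 \<le> (C / d * \<bar>x i - y j\<bar>)\<^sup>2" by (intro power_mono) auto
        then show ?thesis by (simp add: power_mult_distrib power_divide add_increasing)
      qed
      have "(norm (matfun f X - matfun f X0))\<^sup>2 \<le> (\<Sum>i\<in>UNIV. \<Sum>j\<in>UNIV. w i j * (a\<^sup>2 + (C / d)\<^sup>2 * (x i - y j)\<^sup>2))"
        unfolding norm_matfun_diff_power2[OF js X X0] by (intro sum_mono mult_left_mono w bound)
      also have "\<dots> = (\<Sum>i\<in>UNIV. \<Sum>j\<in>UNIV. w i j * a\<^sup>2) + (C / d)\<^sup>2 * (norm (X - X0))\<^sup>2"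
        unfolding nX by (simp add: distrib_left sum.distrib sum_distrib_left mult.left_commute)
      also have "(\<Sum>i\<in>UNIV. \<Sum>j\<in>UNIV. w i j * a\<^sup>2) = CARD('p) * a\<^sup>2"
        by (simp add: row flip: sum_distrib_right)
      also have "\<dots> = (e / 2)\<^sup>2" by (simp add: a_def power_divide power_mult_distrib)
      also have "(C / d)\<^sup>2 * (norm (X - X0))\<^sup>2 = (C / d * norm (X - X0))\<^sup>2" by (simp only: power_mult_distrib)
      also have "\<dots> \<le> (C / d * (d * e / (2 * C)))\<^sup>2"
        using Xt C d by (intro power_mono mult_left_mono) (auto simp: t_def dist_norm)
      also have "C / d * (d * e / (2 * C)) = e / 2" using C d by simp
      also have "(e / 2)\<^sup>2 + (e / 2)\<^sup>2 < e\<^sup>2" using e by (simp add: power_divide)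
      finally show "dist (matfun f X) (matfun f X0) < e"
        unfolding dist_norm using e by (auto intro: power2_less_imp_less)
    qed
  qed
qed

lemma continuous_on_matfun_symmetric:
  assumes "\<And>x. isCont f x"
  shows "continuous_on {X :: real ^ 'p ^ 'p. transpose X = X} (matfun f)"
  using assms by (auto simp: continuous_on_eq_continuous_within intro!: continuous_matfun)

lemma continuous_on_matfun_spd:
  assumes "\<And>x. x > 0 \<Longrightarrow> isCont f x"
  shows "continuous_on (spd :: (real ^ 'p ^ 'p) set) (matfun f)"
proof -
  have "continuous (at X within spd) (matfun f)" if "X \<in> spd" for X :: "real ^ 'p ^ 'p"
    by (rule continuous_within_subset[OF continuous_matfun]) (use assms that spdD in auto)
  then show ?thesis by (simp add: continuous_on_eq_continuous_within)
qed

section \<open>Square roots and inverses\<close>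

lemma msqrt_in_spd: "X \<in> spd \<Longrightarrow> msqrt X \<in> spd"
  unfolding msqrt_def by (rule matfun_in_spd) auto

lemma minvsqrt_in_spd: "X \<in> spd \<Longrightarrow> minvsqrt X \<in> spd"
  unfolding minvsqrt_def by (rule matfun_in_spd) auto

lemma transpose_msqrt [simp]: "X \<in> spd \<Longrightarrow> transpose (msqrt X) = msqrt X"
  by (simp add: msqrt_in_spd spdD)

lemma transpose_minvsqrt [simp]: "X \<in> spd \<Longrightarrow> transpose (minvsqrt X) = minvsqrt X"
  by (simp add: minvsqrt_in_spd spdD)

lemma msqrt_mult_msqrt:
  assumes "X \<in> spd"
  shows "msqrt X ** msqrt X = X"
proof -
  have "msqrt X ** msqrt X = matfun (\<lambda>x. x) X"
    unfolding msqrt_def matfun_mult[OF spdD(1)[OF assms]] by (rule matfun_cong[OF assms]) auto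
  then show ?thesis by (simp add: matfun_id spdD[OF assms])
qed

lemma minvsqrt_mult_minvsqrt:
  assumes "X \<in> spd"
  shows "minvsqrt X ** minvsqrt X = matfun inverse X"
  unfolding minvsqrt_def matfun_mult[OF spdD(1)[OF assms]]
  by (rule matfun_cong[OF assms]) (auto simp: field_simps)

lemma msqrt_mult_minvsqrt:
  assumes "X \<in> spd"
  shows "msqrt X ** minvsqrt X = mat 1"
proof -
  have "msqrt X ** minvsqrt X = matfun (\<lambda>x. 1) X"
    unfolding msqrt_def minvsqrt_def matfun_mult[OF spdD(1)[OF assms]] by (rule matfun_cong[OF assms]) auto
  then show ?thesis by (simp add: matfun_const spdD[OF assms])
qed

lemma minvsqrt_mult_msqrt:
  assumes "X \<in> spd"
  shows "minvsqrt X ** msqrt X = mat 1"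
  using msqrt_mult_minvsqrt[OF assms] matrix_left_right_inverse by blast

lemma matfun_inverse_mult:
  assumes "X \<in> spd"
  shows "matfun inverse X ** X = mat 1"
proof -
  have "matfun inverse X ** X = matfun inverse X ** matfun (\<lambda>x. x) X"
    by (simp add: matfun_id spdD[OF assms])
  also have "\<dots> = matfun (\<lambda>x. 1) X"
    unfolding matfun_mult[OF spdD(1)[OF assms]] by (rule matfun_cong[OF assms]) auto
  finally show ?thesis by (simp add: matfun_const spdD[OF assms])
qed

lemma matfun_inverse_unique:
  assumes "X \<in> spd" "X ** Y = mat 1"
  shows "matfun inverse X = Y"
  by (metis assms matfun_inverse_mult matrix_mul_assoc matrix_mul_lid matrix_mul_rid)

section \<open>Congruence and whitening\<close>

lemma congruence_in_spd:
  fixes P :: "real ^ 'p ^ 'p"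
  assumes X: "X \<in> spd" and P: "Q ** P = mat 1"
  shows "transpose P ** X ** P \<in> spd"
  unfolding spd_def
proof (intro CollectI conjI allI impI)
  show "transpose (transpose P ** X ** P) = transpose P ** X ** P"
    by (simp add: matrix_transpose_mul spdD[OF X] matrix_mul_assoc)
  fix v :: "real ^ 'p" assume "v \<noteq> 0"
  moreover have "Q *v (P *v v) = v" by (simp add: matrix_vector_mul_assoc P)
  ultimately have "P *v v \<noteq> 0" by auto
  from spdD(2)[OF X this] have "0 < (P *v v) \<bullet> (X *v (P *v v))" .
  also have "\<dots> = v \<bullet> ((transpose P ** X ** P) *v v)"
    by (metis dot_lmul_matrix inner_commute matrix_vector_mul_assoc transpose_matrix_vector)
  finally show "0 < v \<bullet> ((transpose P ** X ** P) *v v)" .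
qed

lemma msqrt_conj_in_spd:
  assumes "X \<in> spd" "Y \<in> spd"
  shows "msqrt X ** Y ** msqrt X \<in> spd"
  using congruence_in_spd[OF assms(2) minvsqrt_mult_msqrt[OF assms(1)]] assms by simp

lemma minvsqrt_conj_in_spd:
  assumes "X \<in> spd" "Y \<in> spd"
  shows "minvsqrt X ** Y ** minvsqrt X \<in> spd"
  using congruence_in_spd[OF assms(2) msqrt_mult_minvsqrt[OF assms(1)]] assms by simp

lemma msqrt_minvsqrt_conj:
  assumes "X \<in> spd"
  shows "msqrt X ** (minvsqrt X ** Y ** minvsqrt X) ** msqrt X = Y"
proof -
  have "msqrt X ** (minvsqrt X ** Y ** minvsqrt X) ** msqrt X = (msqrt X ** minvsqrt X) ** Y ** (minvsqrt X ** msqrt X)"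
    by (simp only: matrix_mul_assoc)
  then show ?thesis by (simp add: msqrt_mult_minvsqrt minvsqrt_mult_msqrt assms)
qed

lemma minvsqrt_msqrt_conj:
  assumes "X \<in> spd"
  shows "minvsqrt X ** (msqrt X ** Y ** msqrt X) ** minvsqrt X = Y"
proof -
  have "minvsqrt X ** (msqrt X ** Y ** msqrt X) ** minvsqrt X = (minvsqrt X ** msqrt X) ** Y ** (msqrt X ** minvsqrt X)"
    by (simp only: matrix_mul_assoc)
  then show ?thesis by (simp add: msqrt_mult_minvsqrt minvsqrt_mult_msqrt assms)
qed

lemma inner_msqrt_minvsqrt_conj:
  assumes "X \<in> spd"
  shows "(msqrt X ** M ** msqrt X) \<bullet> (minvsqrt X ** N ** minvsqrt X) = M \<bullet> N"
proof -
  have "(msqrt X ** M ** msqrt X) \<bullet> (minvsqrt X ** N ** minvsqrt X)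
      = M \<bullet> (msqrt X ** (minvsqrt X ** N ** minvsqrt X) ** msqrt X)"
    by (subst inner_matrix_mult_right, subst inner_matrix_mult_left) (simp add: assms matrix_mul_assoc)
  then show ?thesis by (simp add: msqrt_minvsqrt_conj assms)
qed

section \<open>The distance\<close>

lemma trace_matfun_eigenvalues:
  fixes X :: "real ^ 'p ^ 'p"
  assumes X: "transpose X = X"
  obtains x :: "'p \<Rightarrow> real" where "\<And>f. matfun f X \<bullet> mat 1 = (\<Sum>i\<in>UNIV. f (x i))"
    "\<And>i. X \<in> spd \<Longrightarrow> x i > 0"
proof -
  obtain w x y where js: "joint_spectrum X X w x y"
    using joint_spectrum_exists[OF X X] .
  have "matfun f X \<bullet> mat 1 = (\<Sum>i\<in>UNIV. f (x i))" for f
    using joint_spectrumD(4)[OF js, of f "\<lambda>_. 1"]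
    by (simp add: matfun_const X joint_spectrumD(2)[OF js] flip: sum_distrib_right sum_distrib_left)
  with joint_spectrumD(5)[OF js] that show ?thesis by blast
qed

text \<open>\<open>M\<close> is similar to \<open>N\<close> through \<open>P\<close>. Intertwining
  moves \<open>f\<close> past \<open>P\<close>, and cyclicity of the trace cancels \<open>P\<close>
  against its inverse.\<close>

lemma trace_matfun_similar:
  fixes M N P :: "real ^ 'p ^ 'p"
  assumes M: "transpose M = M" and N: "transpose N = N" and MP: "M ** P = P ** N"
    and PQ: "P ** Q = mat 1"
  shows "matfun f M \<bullet> mat 1 = matfun f N \<bullet> mat 1"
proof -
  have QP: "Q ** P = mat 1" using PQ matrix_left_right_inverse by blast
  have "matfun f M = (matfun f M ** P) ** Q" by (simp add: PQ flip: matrix_mul_assoc)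
  also have "\<dots> = P ** matfun f N ** Q" by (simp add: matfun_intertwine[OF M N MP])
  finally have "matfun f M \<bullet> mat 1 = (P ** matfun f N ** Q) \<bullet> mat 1" by simp
  also have "\<dots> = matfun f N \<bullet> (transpose P ** transpose Q)"
    by (subst inner_matrix_mult_right, subst inner_matrix_mult_left) simp
  also have "transpose P ** transpose Q = mat 1"
    by (simp add: QP flip: matrix_transpose_mul)
  finally show ?thesis .
qed

text \<open>The hypothesis says \<open>M = R A X\<inverse> R\<inverse>\<close>: the distance depends on the spectrum of \<open>A X\<inverse>\<close> only.\<close>

lemma spd_dist_eq_norm_mlog:
  fixes A X M R :: "real ^ 'p ^ 'p"
  assumes X: "X \<in> spd" and A: "A \<in> spd" and M: "transpose M = M"
    and R: "R ** R' = mat 1" and eq: "M ** R ** X = R ** A"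
  shows "spd_dist A X = norm (mlog M)"
proof -
  let ?N = "minvsqrt X ** A ** minvsqrt X" and ?P = "R ** msqrt X"
  have N: "?N \<in> spd" using minvsqrt_conj_in_spd X A by blast
  have "M ** ?P = (M ** R ** X) ** minvsqrt X"
  proof -
    have "(M ** R ** X) ** minvsqrt X = M ** R ** (msqrt X ** (msqrt X ** minvsqrt X))"
      using msqrt_mult_msqrt[OF X] by (simp only: matrix_mul_assoc)
    then show ?thesis by (simp add: msqrt_mult_minvsqrt X matrix_mul_assoc)
  qed
  also have "\<dots> = R ** (msqrt X ** minvsqrt X) ** A ** minvsqrt X"
    by (simp add: eq msqrt_mult_minvsqrt X)
  also have "\<dots> = ?P ** ?N" by (simp only: matrix_mul_assoc)
  finally have MP: "M ** ?P = ?P ** ?N" .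
  have "?P ** (minvsqrt X ** R') = R ** (msqrt X ** minvsqrt X) ** R'"
    by (simp only: matrix_mul_assoc)
  then have "?P ** (minvsqrt X ** R') = mat 1"
    by (simp add: msqrt_mult_minvsqrt X R)
  from trace_matfun_similar[OF M spdD(1)[OF N] MP this, of "\<lambda>x. (ln x)\<^sup>2"]
  have "(norm (mlog M))\<^sup>2 = (norm (mlog ?N))\<^sup>2"
    by (simp add: mlog_def norm_matfun_power2 M spdD(1)[OF N])
  then show ?thesis by (simp add: spd_dist_def)
qed

text \<open>The congruence replaces \<open>A X^-1\<close> by a similar matrix. This invariance
  allows later estimates to be made with the base point moved to the identity.\<close>

lemma spd_dist_minvsqrt_conj:
  fixes A X Y :: "real ^ 'p ^ 'p"
  assumes X: "X \<in> spd" and A: "A \<in> spd" and Y: "Y \<in> spd"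
  shows "spd_dist (minvsqrt Y ** A ** minvsqrt Y) (minvsqrt Y ** X ** minvsqrt Y) = spd_dist A X"
    (is "spd_dist ?A ?X = _")
proof -
  let ?M = "minvsqrt X ** A ** minvsqrt X" and ?R = "minvsqrt X ** msqrt Y"
  have "?M ** ?R ** ?X = minvsqrt X ** A ** (minvsqrt X ** minvsqrt X) ** (msqrt Y ** minvsqrt Y) ** X ** minvsqrt Y"
    by (simp only: matrix_mul_assoc)
  also have "\<dots> = minvsqrt X ** A ** (matfun inverse X ** X) ** minvsqrt Y"
    by (simp only: minvsqrt_mult_minvsqrt[OF X] msqrt_mult_minvsqrt[OF Y] matrix_mul_rid matrix_mul_assoc)
  also have "\<dots> = minvsqrt X ** (msqrt Y ** minvsqrt Y) ** A ** minvsqrt Y"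
    by (simp add: matfun_inverse_mult[OF X] msqrt_mult_minvsqrt[OF Y])
  also have "\<dots> = ?R ** ?A" by (simp only: matrix_mul_assoc)
  finally have eq: "?M ** ?R ** ?X = ?R ** ?A" .
  have "?R ** (minvsqrt Y ** msqrt X) = minvsqrt X ** (msqrt Y ** minvsqrt Y) ** msqrt X"
    by (simp only: matrix_mul_assoc)
  then have R: "?R ** (minvsqrt Y ** msqrt X) = mat 1"
    by (simp add: msqrt_mult_minvsqrt minvsqrt_mult_msqrt X Y)
  have "spd_dist ?A ?X = norm (mlog ?M)"
    by (rule spd_dist_eq_norm_mlog[OF _ _ _ R eq]) (use minvsqrt_conj_in_spd spdD X A Y in blast)+
  then show ?thesis by (simp add: spd_dist_def)
qed

section \<open>The exponential metric increasing property\<close>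

text \<open>The second derivative in \<open>u\<close> of the left-hand side minus the right-hand side is nonnegative by AM-GM.\<close>

lemma majorizer_scalar:
  fixes u l :: real
  defines "s \<equiv> sqrt (l\<^sup>2 + 1)"
  shows "s * (exp u + exp (- u) - 2) - l * (exp u - exp (- u) - 2 * u) \<ge> u\<^sup>2"
proof -
  define \<phi> where "\<phi> = (\<lambda>u. s * (exp u + exp (- u) - 2) - l * (exp u - exp (- u) - 2 * u) - u\<^sup>2)"
  define \<phi>' where "\<phi>' = (\<lambda>u. s * (exp u - exp (- u)) - l * (exp u + exp (- u) - 2) - 2 * u)"
  have s: "s\<^sup>2 = l\<^sup>2 + 1" "s > \<bar>l\<bar>"
    unfolding s_def by (auto intro: real_less_rsqrt)
  have d1: "(\<phi> has_real_derivative \<phi>' u) (at u)" for u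
    unfolding \<phi>_def \<phi>'_def by (auto intro!: derivative_eq_intros simp: algebra_simps)
  have d2: "(\<phi>' has_real_derivative s * (exp u + exp (- u)) - l * (exp u - exp (- u)) - 2) (at u)" for u
    unfolding \<phi>'_def by (auto intro!: derivative_eq_intros simp: algebra_simps)
  have "s * (exp u + exp (- u)) - l * (exp u - exp (- u)) - 2 \<ge> 0" for u
  proof -
    define a b where "a = sqrt ((s - l) * exp u)" and "b = sqrt ((s + l) * exp (- u))"
    have "a * b = sqrt ((s - l) * (s + l) * (exp u * exp (- u)))"
      by (simp add: a_def b_def real_sqrt_mult[symmetric] ac_simps)
    also have "(s - l) * (s + l) = 1" using s by (simp add: algebra_simps power2_eq_square)
    finally have "a * b = 1" by (simp add: exp_minus)
    moreover have "a\<^sup>2 = (s - l) * exp u" "b\<^sup>2 = (s + l) * exp (- u)"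
      using s by (auto simp: a_def b_def)
    moreover have "0 \<le> (a - b)\<^sup>2" by simp
    ultimately show ?thesis by (simp add: power2_diff algebra_simps)
  qed
  then have "convex_on UNIV \<phi>"
    by (intro f''_ge0_imp_convex[of UNIV \<phi> \<phi>']) (use d1 d2 in auto)
  \<comment> \<open>Both the difference and its derivative vanish at 0, so the tangent there is the
    zero function.\<close>
  from convex_on_imp_above_tangent[OF this _ _ _ has_field_derivative_at_within[OF d1[of 0]], of u]
  show ?thesis by (simp add: \<phi>_def \<phi>'_def)
qed

lemma ln_diff_power2_le:
  assumes "x > 0" "y > (0 :: real)"
  shows "(ln x - ln y)\<^sup>2 \<le> inverse x * y + x * inverse y - 2"
  using majorizer_scalar[of "ln x - ln y" 0] assms
  by (simp add: exp_diff exp_minus field_simps)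

text \<open>The bound is the sum of \<open>z + 1/z - 2\<close> over the eigenvalues \<open>z\<close>
  of \<open>X^-1 Y\<close>. It agrees with the squared distance to leading order for nearby points,
  which is what makes it sharp after subdivision.\<close>

lemma norm_mlog_diff_power2_le:
  fixes X Y :: "real ^ 'p ^ 'p"
  assumes X: "X \<in> spd" and Y: "Y \<in> spd"
  shows "(norm (mlog X - mlog Y))\<^sup>2 \<le> matfun inverse X \<bullet> Y + X \<bullet> matfun inverse Y - 2 * (mat 1 \<bullet> (mat 1 :: real ^ 'p ^ 'p))"
proof -
  note sX = spdD(1)[OF X] and sY = spdD(1)[OF Y]
  obtain w x y where js: "joint_spectrum X Y w x y"
    using joint_spectrum_exists[OF sX sY] .
  note w = joint_spectrumD(1)[OF js] and tr = joint_spectrumD(4)[OF js]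
    and pos = joint_spectrumD(5)[OF js X] joint_spectrumD(6)[OF js Y]
  have "(norm (mlog X - mlog Y))\<^sup>2 = (\<Sum>i\<in>UNIV. \<Sum>j\<in>UNIV. w i j * (ln (x i) - ln (y j))\<^sup>2)"
    unfolding mlog_def by (rule norm_matfun_diff_power2[OF js sX sY])
  also have "\<dots> \<le> (\<Sum>i\<in>UNIV. \<Sum>j\<in>UNIV. w i j * (inverse (x i) * y j + x i * inverse (y j) - 2))"
    by (intro sum_mono mult_left_mono ln_diff_power2_le pos w)
  also have "\<dots> = matfun inverse X \<bullet> matfun (\<lambda>x. x) Y + matfun (\<lambda>x. x) X \<bullet> matfun inverse Y
       - 2 * (matfun (\<lambda>_. 1) X \<bullet> matfun (\<lambda>_. 1) Y)"
    unfolding tr by (simp add: sum.distrib[symmetric] sum_subtractf[symmetric] sum_distrib_left algebra_simps)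
  finally show ?thesis by (simp add: matfun_id matfun_const sX sY)
qed

text \<open>
  Apply the previous bound to consecutive points of a fine subdivision of the geodesic
  \<open>t \<mapsto> X\<^sup>1\<^sup>/\<^sup>2 Z\<^sup>t X\<^sup>1\<^sup>/\<^sup>2\<close> from \<open>X\<close> to \<open>A\<close>, for which the error of the bound disappears in the limit.
\<close>

theorem norm_mlog_diff_le_spd_dist:
  fixes A X :: "real ^ 'p ^ 'p"
  assumes X: "X \<in> spd" and A: "A \<in> spd"
  shows "norm (mlog X - mlog A) \<le> spd_dist A X"
proof -
  define Z where "Z = minvsqrt X ** A ** minvsqrt X"
  have Z: "Z \<in> spd" unfolding Z_def by (rule minvsqrt_conj_in_spd[OF X A])
  note sZ = spdD(1)[OF Z]
  define Q where "Q = (\<lambda>t. matfun (\<lambda>z. z powr t) Z)"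
  have Q: "Q t \<in> spd" for t unfolding Q_def by (rule matfun_in_spd[OF Z]) auto
  have QQ: "Q s ** Q t = Q (s + t)" for s t
    unfolding Q_def matfun_mult[OF sZ] by (simp add: powr_add)
  have QiQ: "Q s \<bullet> Q t = Q (s + t) \<bullet> mat 1" for s t
    unfolding Q_def inner_matfun_same[OF sZ] by (simp add: powr_add)
  have Q0: "Q 0 = mat 1"
  proof -
    have "Q 0 = matfun (\<lambda>_. 1) Z" unfolding Q_def by (rule matfun_cong[OF Z]) simp
    then show ?thesis by (simp add: matfun_const sZ)
  qed
  have Q1: "Q 1 = Z"
  proof -
    have "Q 1 = matfun (\<lambda>x. x) Z" unfolding Q_def by (rule matfun_cong[OF Z]) simp
    then show ?thesis by (simp add: matfun_id sZ)
  qed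
  define G where "G = (\<lambda>t. msqrt X ** Q t ** msqrt X)"
  have G: "G t \<in> spd" for t unfolding G_def by (rule msqrt_conj_in_spd[OF X Q])
  have G0: "G 0 = X" by (simp add: G_def Q0 msqrt_mult_msqrt X)
  have G1: "G 1 = A" by (simp add: G_def Q1 Z_def msqrt_minvsqrt_conj X)
  have Ginv: "matfun inverse (G t) = minvsqrt X ** Q (- t) ** minvsqrt X" for t
  proof (rule matfun_inverse_unique[OF G])
    have "G t ** (minvsqrt X ** Q (- t) ** minvsqrt X) = msqrt X ** Q t ** (msqrt X ** minvsqrt X) ** Q (- t) ** minvsqrt X"
      by (simp only: G_def matrix_mul_assoc)
    also have "\<dots> = msqrt X ** (Q t ** Q (- t)) ** minvsqrt X"
      by (simp only: msqrt_mult_minvsqrt[OF X] matrix_mul_rid matrix_mul_assoc)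
    finally show "G t ** (minvsqrt X ** Q (- t) ** minvsqrt X) = mat 1"
      by (simp add: QQ Q0 msqrt_mult_minvsqrt X)
  qed
  have inner: "G s \<bullet> matfun inverse (G t) = Q (s - t) \<bullet> mat 1" for s t
    unfolding Ginv unfolding G_def by (simp add: inner_msqrt_minvsqrt_conj X QiQ)
  obtain z :: "'p \<Rightarrow> real" where tr: "\<And>f. matfun f Z \<bullet> mat 1 = (\<Sum>i\<in>UNIV. f (z i))" and pos: "\<And>i. z i > 0"
    using trace_matfun_eigenvalues[OF sZ] Z by metis
  \<comment> \<open>The bound for two points of the geodesic whose parameters differ by
    \<open>r\<close>, that is, the sum of \<open>4 sinh^2 (r ln z / 2)\<close> over the eigenvalues
    \<open>z\<close> of \<open>Z\<close>.\<close>
  define e where "e = (\<lambda>r. \<Sum>i\<in>UNIV. z i powr r + z i powr (- r) - 2)"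
  have step: "(norm (mlog (G s) - mlog (G t)))\<^sup>2 \<le> e (s - t)" for s t
  proof -
    have "matfun inverse (G s) \<bullet> G t + G s \<bullet> matfun inverse (G t) - 2 * (mat 1 \<bullet> (mat 1 :: real ^ 'p ^ 'p))
        = matfun (\<lambda>z. z powr (t - s)) Z \<bullet> mat 1 + matfun (\<lambda>z. z powr (s - t)) Z \<bullet> mat 1 - 2 * (matfun (\<lambda>_. 1) Z \<bullet> mat 1)"
      using inner[of t s] inner[of s t] by (simp add: inner_commute Q_def matfun_const sZ)
    also have "\<dots> = e (s - t)"
      unfolding tr e_def by (simp add: sum.distrib sum_subtractf)
    finally show ?thesis using norm_mlog_diff_power2_le[OF G G, of s t] by simp
  qed
  \<comment> \<open>Triangle inequality over \<open>N\<close> equal parameter steps, each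
    contributing at most \<open>sqrt (e (1/N))\<close>.\<close>
  have bound: "(norm (mlog A - mlog X))\<^sup>2 \<le> (real N)\<^sup>2 * e (1 / real N)" if "N > 0" for N
  proof -
    have "mlog A - mlog X = (\<Sum>k<N. mlog (G (real (Suc k) / N)) - mlog (G (real k / N)))"
      using sum_lessThan_telescope[of "\<lambda>k. mlog (G (real k / N))" N] that by (simp add: G0 G1)
    also have "norm \<dots> \<le> (\<Sum>k<N. sqrt (e (1 / real N)))"
    proof (rule sum_norm_le)
      fix k
      have "real (Suc k) / N - real k / N = 1 / N" using that by (simp add: field_simps)
      then show "norm (mlog (G (real (Suc k) / N)) - mlog (G (real k / N))) \<le> sqrt (e (1 / real N))"
        using step[of "real (Suc k) / N" "real k / N"] real_le_rsqrt by metis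
    qed
    finally have "(norm (mlog A - mlog X))\<^sup>2 \<le> (N * sqrt (e (1 / real N)))\<^sup>2"
      by (intro power_mono) auto
    moreover have "e (1 / real N) \<ge> 0"
      using step[of "1 / N" 0] by (smt (verit) zero_le_power2)
    ultimately show ?thesis by (simp add: power_mult_distrib)
  qed
  \<comment> \<open>To leading order the bracket is \<open>(ln z)^2 / N^2\<close>, which cancels the
    factor \<open>N^2\<close>.\<close>
  have "(\<lambda>N. (real N)\<^sup>2 * (z powr (1 / real N) + z powr (- (1 / real N)) - 2)) \<longlonglongrightarrow> (ln z)\<^sup>2" if "z > 0" for z :: real
    using that by (simp only: power2_eq_square[of "ln z"]) real_asymp
  then have "(\<lambda>N. (real N)\<^sup>2 * e (1 / real N)) \<longlonglongrightarrow> (\<Sum>i\<in>UNIV. (ln (z i))\<^sup>2)"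
    unfolding e_def sum_distrib_left by (intro tendsto_sum) (auto simp: pos)
  then have "(norm (mlog A - mlog X))\<^sup>2 \<le> (\<Sum>i\<in>UNIV. (ln (z i))\<^sup>2)"
    by (rule LIMSEQ_le_const) (use bound in \<open>auto intro!: exI[of _ 1]\<close>)
  also have "\<dots> = (norm (mlog Z))\<^sup>2"
    by (simp add: mlog_def norm_matfun_power2 sZ tr)
  finally show ?thesis
    by (simp add: spd_dist_def Z_def norm_minus_commute)
qed

section \<open>The majorizer\<close>

lemma inverse_minvsqrt_conj:
  assumes X: "X \<in> spd" and A: "A \<in> spd"
  shows "matfun inverse (minvsqrt X ** A ** minvsqrt X) = msqrt X ** matfun inverse A ** msqrt X"
proof (rule matfun_inverse_unique[OF minvsqrt_conj_in_spd[OF X A]])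
  have AA: "A ** matfun inverse A = mat 1"
    using matfun_inverse_mult[OF A] matrix_left_right_inverse by blast
  have "minvsqrt X ** A ** minvsqrt X ** (msqrt X ** matfun inverse A ** msqrt X)
      = minvsqrt X ** A ** (minvsqrt X ** msqrt X) ** matfun inverse A ** msqrt X"
    by (simp only: matrix_mul_assoc)
  also have "\<dots> = minvsqrt X ** (A ** matfun inverse A) ** msqrt X"
    by (simp only: minvsqrt_mult_msqrt[OF X] matrix_mul_rid matrix_mul_assoc)
  finally show "minvsqrt X ** A ** minvsqrt X ** (msqrt X ** matfun inverse A ** msqrt X) = mat 1"
    by (simp add: AA minvsqrt_mult_msqrt X)
qed

lemma sum_in_spd:
  fixes f :: "'b \<Rightarrow> real ^ 'p ^ 'p"
  assumes "finite I" "I \<noteq> {}" "\<And>i. i \<in> I \<Longrightarrow> f i \<in> spd"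
  shows "(\<Sum>i\<in>I. f i) \<in> spd"
  unfolding spd_def
proof (intro CollectI conjI allI impI)
  show "transpose (\<Sum>i\<in>I. f i) = (\<Sum>i\<in>I. f i)"
    using assms by (simp add: transpose_sum spdD)
  fix v :: "real ^ 'p" assume "v \<noteq> 0"
  then have "0 < (\<Sum>i\<in>I. v \<bullet> (f i *v v))"
    using assms by (intro sum_pos) (auto simp: spdD)
  also have "\<dots> = v \<bullet> ((\<Sum>i\<in>I. f i) *v v)"
    using assms(1) by (induction rule: finite_induct) (auto simp: inner_add_right matrix_vector_mult_add_rdistrib)
  finally show "0 < v \<bullet> ((\<Sum>i\<in>I. f i) *v v)" .
qed

text \<open>
  \<open>k1 b = g1 (1/b) / b\<close> and \<open>k2 b = b * g2 (1/b)\<close>: the functions that \<open>g1\<close> and \<open>g2\<close> become after whitening.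
  The constant \<open>k0\<close> is the one for which the majorizer touches at \<open>m = b\<close> in \<open>majorizer_scalar_pair\<close>.
\<close>

definition k1 :: "real \<Rightarrow> real" where
  "k1 x = sqrt ((ln x)\<^sup>2 + 1) - ln x"

definition k2 :: "real \<Rightarrow> real" where
  "k2 x = sqrt ((ln x)\<^sup>2 + 1) + ln x"

definition k0 :: "real \<Rightarrow> real" where
  "k0 x = 2 * sqrt ((ln x)\<^sup>2 + 1) - (ln x)\<^sup>2"

lemma abs_less_sqrt_power2_add_1: "\<bar>l\<bar> < sqrt (l\<^sup>2 + 1)"
  by (rule real_less_rsqrt) simp

lemma k1_pos: "k1 x > 0"
  using abs_less_sqrt_power2_add_1[of "ln x"] by (simp add: k1_def)

lemma k2_pos: "k2 x > 0"
  using abs_less_sqrt_power2_add_1[of "ln x"] by (simp add: k2_def)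

text \<open>With \<open>l = ln b\<close> and \<open>u = ln b - ln m\<close>, completing the square
  gives \<open>u^2 - 2 l u + l^2 = (ln m)^2\<close>; the leftover constants form
  \<open>k0 b\<close>.\<close>

lemma majorizer_scalar_pair:
  assumes "b > 0" "m > 0"
  shows "(ln m)\<^sup>2 \<le> b * k1 b * inverse m + k2 b / b * m - k0 b"
proof -
  have "exp (ln b - ln m) = b * inverse m" "exp (- (ln b - ln m)) = m / b"
    using assms by (simp_all add: exp_diff divide_inverse)
  with majorizer_scalar[where u = "ln b - ln m" and l = "ln b"] show ?thesis
    by (simp add: k1_def k2_def k0_def power2_eq_square add_divide_distrib algebra_simps)
qed

text \<open>\<open>M\<close> has the spectrum of \<open>B Y^-1\<close>, hence carries the distance.
  Cyclicity of the trace rewrites both terms as pairings of a function of \<open>B\<close> with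
  \<open>M\<close> or its inverse, so the scalar inequality applies over the joint spectrum of
  \<open>B\<close> and \<open>M\<close>.\<close>

lemma spd_dist_power2_le_majorizer:
  fixes B Y :: "real ^ 'p ^ 'p"
  assumes B: "B \<in> spd" and Y: "Y \<in> spd"
  shows "(spd_dist B Y)\<^sup>2 \<le> matfun k1 B \<bullet> Y + matfun k2 B \<bullet> matfun inverse Y - matfun k0 B \<bullet> mat 1"
proof -
  define M where "M = msqrt B ** matfun inverse Y ** msqrt B"
  define Z where "Z = minvsqrt B ** Y ** minvsqrt B"
  have Z: "Z \<in> spd" and Yi: "matfun inverse Y \<in> spd"
    unfolding Z_def by (auto intro: minvsqrt_conj_in_spd B Y matfun_in_spd)
  then have M: "M \<in> spd" unfolding M_def by (auto intro: msqrt_conj_in_spd B)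
  have "M = matfun inverse Z" unfolding M_def Z_def by (simp add: inverse_minvsqrt_conj B Y)
  then have MZ: "matfun inverse M = Z"
    by (intro matfun_inverse_unique M) (simp add: matfun_inverse_mult[OF Z])
  note sB = spdD(1)[OF B] and sM = spdD(1)[OF M]
  have YYi: "Y ** matfun inverse Y = mat 1"
    using matfun_inverse_mult[OF Y] matrix_left_right_inverse by blast
  have dist: "spd_dist B Y = norm (mlog M)"
  proof (rule spd_dist_eq_norm_mlog[OF Y B sM])
    have "(msqrt B ** matfun inverse Y) ** (Y ** minvsqrt B) = msqrt B ** (matfun inverse Y ** Y) ** minvsqrt B"
      by (simp only: matrix_mul_assoc)
    then show "(msqrt B ** matfun inverse Y) ** (Y ** minvsqrt B) = mat 1"
      by (simp add: matfun_inverse_mult Y msqrt_mult_minvsqrt B)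
    have "M ** (msqrt B ** matfun inverse Y) ** Y
        = msqrt B ** matfun inverse Y ** (msqrt B ** msqrt B) ** (matfun inverse Y ** Y)"
      by (simp only: M_def matrix_mul_assoc)
    then show "M ** (msqrt B ** matfun inverse Y) ** Y = (msqrt B ** matfun inverse Y) ** B"
      by (simp add: matfun_inverse_mult Y msqrt_mult_msqrt B)
  qed
  have 1: "matfun k1 B \<bullet> Y = matfun (\<lambda>b. b * k1 b) B \<bullet> matfun inverse M"
  proof -
    have "matfun k1 B \<bullet> Y = (minvsqrt B ** (msqrt B ** matfun k1 B ** msqrt B) ** minvsqrt B) \<bullet> (msqrt B ** Z ** msqrt B)"
      by (simp add: minvsqrt_msqrt_conj msqrt_minvsqrt_conj B Z_def)
    also have "\<dots> = (msqrt B ** matfun k1 B ** msqrt B) \<bullet> Z"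
      by (metis inner_commute inner_msqrt_minvsqrt_conj B)
    also have "msqrt B ** matfun k1 B ** msqrt B = matfun (\<lambda>b. b * k1 b) B"
      unfolding msqrt_def matfun_mult[OF sB] by (rule matfun_cong[OF B]) (simp add: mult.commute mult.left_commute)
    finally show ?thesis by (simp add: MZ)
  qed
  have 2: "matfun k2 B \<bullet> matfun inverse Y = matfun (\<lambda>b. k2 b / b) B \<bullet> M"
  proof -
    have "matfun k2 B \<bullet> matfun inverse Y
        = (msqrt B ** (minvsqrt B ** matfun k2 B ** minvsqrt B) ** msqrt B) \<bullet> (minvsqrt B ** M ** minvsqrt B)"
      by (simp add: minvsqrt_msqrt_conj msqrt_minvsqrt_conj B M_def)
    also have "\<dots> = (minvsqrt B ** matfun k2 B ** minvsqrt B) \<bullet> M"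
      by (simp add: inner_msqrt_minvsqrt_conj B)
    also have "minvsqrt B ** matfun k2 B ** minvsqrt B = matfun (\<lambda>b. k2 b / b) B"
      unfolding minvsqrt_def matfun_mult[OF sB] by (rule matfun_cong[OF B]) (simp add: field_simps)
    finally show ?thesis .
  qed
  obtain w b m where js: "joint_spectrum B M w b m"
    using joint_spectrum_exists[OF sB sM] .
  note w = joint_spectrumD(1)[OF js] and tr = joint_spectrumD(4)[OF js]
    and pos = joint_spectrumD(5)[OF js B] joint_spectrumD(6)[OF js M]
  have "(spd_dist B Y)\<^sup>2 = matfun (\<lambda>_. 1) B \<bullet> matfun (\<lambda>m. (ln m)\<^sup>2) M"
    by (simp add: dist mlog_def norm_matfun_power2 sM sB matfun_const inner_commute)
  also have "\<dots> = (\<Sum>i\<in>UNIV. \<Sum>j\<in>UNIV. w i j * (ln (m j))\<^sup>2)"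
    unfolding tr by simp
  also have "\<dots> \<le> (\<Sum>i\<in>UNIV. \<Sum>j\<in>UNIV. w i j * (b i * k1 (b i) * inverse (m j) + k2 (b i) / b i * m j - k0 (b i)))"
    by (intro sum_mono mult_left_mono majorizer_scalar_pair pos w)
  also have "\<dots> = matfun (\<lambda>b. b * k1 b) B \<bullet> matfun inverse M + matfun (\<lambda>b. k2 b / b) B \<bullet> matfun (\<lambda>m. m) M
       - matfun k0 B \<bullet> matfun (\<lambda>_. 1) M"
    unfolding tr by (simp add: sum.distrib sum_subtractf distrib_left right_diff_distrib)
  finally show ?thesis by (simp add: 1 2 matfun_id matfun_const sM)
qed

section \<open>Whitened form of \<open>f1\<close> and \<open>f2\<close>\<close>

text \<open>Since \<open>Z = R R^T\<close> and \<open>W = R^T R = B^-1\<close>, the factor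
  \<open>R\<close> intertwines them. Moving \<open>g1\<close> from \<open>Z\<close> to
  \<open>W\<close> leaves \<open>B^-1 g1(B^-1)\<close>, a function of \<open>B\<close>
  alone.\<close>

lemma f1_summand_conj:
  assumes X: "X \<in> spd" and A: "A \<in> spd"
  shows "msqrt X ** (minvsqrt A ** matfun g1 (minvsqrt A ** X ** minvsqrt A) ** minvsqrt A) ** msqrt X
    = matfun k1 (minvsqrt X ** A ** minvsqrt X)"
proof -
  define B Z where "B = minvsqrt X ** A ** minvsqrt X" and "Z = minvsqrt A ** X ** minvsqrt A"
  define R W where "R = minvsqrt A ** msqrt X" and "W = matfun inverse B"
  have B: "B \<in> spd" and Z: "Z \<in> spd" unfolding B_def Z_def using A X minvsqrt_conj_in_spd by blast+
  have W: "W \<in> spd" unfolding W_def by (rule matfun_in_spd[OF B]) auto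
  have W_eq: "W = msqrt X ** (minvsqrt A ** minvsqrt A) ** msqrt X"
    by (simp add: W_def B_def inverse_minvsqrt_conj X A minvsqrt_mult_minvsqrt)
  have "R ** W = minvsqrt A ** (msqrt X ** msqrt X) ** minvsqrt A ** minvsqrt A ** msqrt X"
    by (simp only: R_def W_eq matrix_mul_assoc)
  then have "Z ** R = R ** W"
    by (simp add: msqrt_mult_msqrt X Z_def R_def matrix_mul_assoc)
  then have ZR: "matfun g1 Z ** R = R ** matfun g1 W"
    by (rule matfun_intertwine[OF spdD(1)[OF Z] spdD(1)[OF W]])
  have "msqrt X ** (minvsqrt A ** matfun g1 Z ** minvsqrt A) ** msqrt X
      = msqrt X ** minvsqrt A ** (matfun g1 Z ** R)"
    by (simp only: R_def matrix_mul_assoc)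
  also have "\<dots> = (msqrt X ** minvsqrt A ** R) ** matfun g1 W"
    by (simp only: ZR matrix_mul_assoc)
  also have "msqrt X ** minvsqrt A ** R = W"
    by (simp only: R_def W_eq matrix_mul_assoc)
  also have "W ** matfun g1 W = matfun inverse B ** matfun g1 (matfun inverse B)"
    by (simp only: W_def)
  also have "\<dots> = matfun (\<lambda>b. inverse b * g1 (inverse b)) B"
    unfolding matfun_comp[OF spdD(1)[OF B]] matfun_mult[OF spdD(1)[OF B]] ..
  also have "\<dots> = matfun k1 B"
    by (rule matfun_cong[OF B]) (simp add: g1_def k1_def ln_inverse)
  finally show ?thesis by (simp only: B_def Z_def)
qed

text \<open>The same scheme with \<open>V\<close> in place of \<open>R\<close>: it also intertwines
  \<open>Z\<close> and \<open>W\<close>, but now \<open>V^T V = B\<close>, so what remains is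
  \<open>B g2(B^-1)\<close>.\<close>

lemma f2_summand_conj:
  assumes X: "X \<in> spd" and A: "A \<in> spd"
  shows "minvsqrt X ** (msqrt A ** matfun g2 (minvsqrt A ** X ** minvsqrt A) ** msqrt A) ** minvsqrt X
    = matfun k2 (minvsqrt X ** A ** minvsqrt X)"
proof -
  define B Z where "B = minvsqrt X ** A ** minvsqrt X" and "Z = minvsqrt A ** X ** minvsqrt A"
  define V W where "V = msqrt A ** minvsqrt X" and "W = matfun inverse B"
  have B: "B \<in> spd" and Z: "Z \<in> spd" unfolding B_def Z_def using A X minvsqrt_conj_in_spd by blast+
  have W: "W \<in> spd" unfolding W_def by (rule matfun_in_spd[OF B]) auto
  have W_eq: "W = msqrt X ** (minvsqrt A ** minvsqrt A) ** msqrt X"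
    by (simp add: W_def B_def inverse_minvsqrt_conj X A minvsqrt_mult_minvsqrt)
  have "V ** W = msqrt A ** (minvsqrt X ** msqrt X) ** minvsqrt A ** minvsqrt A ** msqrt X"
    by (simp only: V_def W_eq matrix_mul_assoc)
  also have "\<dots> = minvsqrt A ** msqrt X"
    by (simp add: minvsqrt_mult_msqrt X msqrt_mult_minvsqrt A)
  \<comment> \<open>Factors multiplying to the identity are inserted so that \<open>Z ** V\<close>
    can be read off.\<close>
  also have "\<dots> = minvsqrt A ** (msqrt X ** msqrt X) ** (minvsqrt A ** msqrt A) ** minvsqrt X"
    by (simp add: minvsqrt_mult_msqrt A) (simp add: msqrt_mult_minvsqrt X flip: matrix_mul_assoc)
  also have "\<dots> = Z ** V"
    unfolding msqrt_mult_msqrt[OF X] by (simp only: Z_def V_def matrix_mul_assoc)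
  finally have ZV: "matfun g2 Z ** V = V ** matfun g2 W"
    by (intro matfun_intertwine spdD(1) Z W) simp
  have "minvsqrt X ** (msqrt A ** matfun g2 Z ** msqrt A) ** minvsqrt X
      = minvsqrt X ** msqrt A ** (matfun g2 Z ** V)"
    by (simp only: V_def matrix_mul_assoc)
  also have "\<dots> = minvsqrt X ** msqrt A ** V ** matfun g2 W"
    by (simp only: ZV matrix_mul_assoc)
  also have "\<dots> = minvsqrt X ** (msqrt A ** msqrt A) ** minvsqrt X ** matfun g2 W"
    by (simp only: V_def matrix_mul_assoc)
  also have "\<dots> = matfun (\<lambda>b. b) B ** matfun g2 W"
    by (simp only: msqrt_mult_msqrt[OF A] matfun_id[OF spdD(1)[OF B]]) (simp only: B_def)
  also have "\<dots> = matfun (\<lambda>b. b * g2 (inverse b)) B"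
    unfolding W_def matfun_comp[OF spdD(1)[OF B]] matfun_mult[OF spdD(1)[OF B]] ..
  also have "\<dots> = matfun k2 B"
    by (rule matfun_cong[OF B]) (simp add: g2_def k2_def ln_inverse)
  finally show ?thesis by (simp only: B_def Z_def)
qed

lemma f1_conj:
  assumes "X \<in> spd" "\<And>i. i \<in> {1..n} \<Longrightarrow> A i \<in> spd"
  shows "msqrt X ** f1 n A X ** msqrt X = (\<Sum>i=1..n. matfun k1 (minvsqrt X ** A i ** minvsqrt X))"
  using assms by (simp add: f1_def matmul.sum_left matmul.sum_right f1_summand_conj)

lemma f2_conj:
  assumes "X \<in> spd" "\<And>i. i \<in> {1..n} \<Longrightarrow> A i \<in> spd"
  shows "minvsqrt X ** f2 n A X ** minvsqrt X = (\<Sum>i=1..n. matfun k2 (minvsqrt X ** A i ** minvsqrt X))"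
  using assms by (simp add: f2_def matmul.sum_left matmul.sum_right f2_summand_conj)

section \<open>The minimizer of the majorizer\<close>

text \<open>The value is the squared norm of \<open>Y^(1/2) K D^(1/2)\<close>. Symmetry of
  \<open>K\<close> suffices, which admits differences of positive definite matrices.\<close>

lemma inner_spd_congruence_nonneg:
  assumes D: "D \<in> spd" and Y: "Y \<in> spd" and K: "transpose K = K"
  shows "D \<bullet> (K ** Y ** K) \<ge> 0"
proof -
  have "D \<bullet> (K ** Y ** K) = (msqrt D ** msqrt D) \<bullet> (K ** (msqrt Y ** msqrt Y) ** K)"
    by (simp add: msqrt_mult_msqrt D Y)
  also have "\<dots> = (K ** (msqrt Y ** (msqrt Y ** K))) \<bullet> (msqrt D ** msqrt D)"
    by (simp only: inner_commute matrix_mul_assoc)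
  also have "\<dots> = (msqrt Y ** K) \<bullet> (msqrt Y ** (K ** (msqrt D ** msqrt D)))"
    by (simp only: inner_matrix_mult_left[of K] inner_matrix_mult_left[of "msqrt Y" "msqrt Y ** K"] K transpose_msqrt[OF Y])
  also have "\<dots> = (msqrt Y ** K ** msqrt D) \<bullet> (msqrt Y ** K ** msqrt D)"
    by (simp only: inner_matrix_mult_right[of "msqrt Y ** K" "msqrt D"] transpose_msqrt[OF D] matrix_mul_assoc)
  finally show ?thesis by simp
qed

text \<open>Completing the square: the right side minus the left is the pairing of \<open>D\<close>
  with \<open>(Y - Y0) Y^-1 (Y - Y0)\<close>.\<close>

lemma trace_majorizer_minimum:
  assumes D: "D \<in> spd" and Y0: "Y0 \<in> spd" and Y: "Y \<in> spd"
  shows "D \<bullet> Y0 + (Y0 ** D ** Y0) \<bullet> matfun inverse Y0 \<le> D \<bullet> Y + (Y0 ** D ** Y0) \<bullet> matfun inverse Y"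
proof -
  have mv: "(Y0 ** D ** Y0) \<bullet> M = D \<bullet> (Y0 ** M ** Y0)" for M
    by (subst inner_matrix_mult_right, subst inner_matrix_mult_left) (simp add: spdD[OF Y0] matrix_mul_assoc)
  have Yi: "matfun inverse Y ** Y = mat 1" "Y ** matfun inverse Y = mat 1"
    using matfun_inverse_mult[OF Y] matrix_left_right_inverse by blast+
  have "0 \<le> D \<bullet> ((Y - Y0) ** matfun inverse Y ** (Y - Y0))"
    by (intro inner_spd_congruence_nonneg D matfun_in_spd[OF Y]) (auto simp: transpose_diff spdD Y Y0)
  also have "(Y - Y0) ** matfun inverse Y ** (Y - Y0) = Y - Y0 - Y0 + Y0 ** matfun inverse Y ** Y0"
    by (simp add: matmul.diff_left matmul.diff_right Yi) (simp add: Yi flip: matrix_mul_assoc)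
  finally have "D \<bullet> Y0 + D \<bullet> Y0 \<le> D \<bullet> Y + D \<bullet> (Y0 ** matfun inverse Y ** Y0)"
    by (simp only: inner_diff_right inner_add_right)
  moreover have "Y0 ** matfun inverse Y0 ** Y0 = Y0"
    by (simp add: matfun_inverse_mult Y0 flip: matrix_mul_assoc)
  ultimately show ?thesis by (simp add: mv)
qed

text \<open>\<open>X\<close> is the geometric mean of \<open>C^-1\<close> and \<open>D\<close>. With
  \<open>C = f1\<close> and \<open>D = f2\<close> it is the update \<open>T\<close>, and the Riccati
  equation is the stationarity condition of the trace majorizer.\<close>

lemma riccati_solution:
  fixes C D :: "real ^ 'p ^ 'p"
  assumes C: "C \<in> spd" and D: "D \<in> spd"
  defines "X \<equiv> msqrt D ** minvsqrt (msqrt D ** C ** msqrt D) ** msqrt D"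
  shows "X \<in> spd" "X ** C ** X = D"
proof -
  define M where "M = msqrt D ** C ** msqrt D"
  have M: "M \<in> spd" unfolding M_def by (rule msqrt_conj_in_spd[OF D C])
  have X: "X = msqrt D ** minvsqrt M ** msqrt D" by (simp add: X_def M_def)
  show "X \<in> spd" unfolding X by (intro msqrt_conj_in_spd D minvsqrt_in_spd M)
  have "X ** C ** X = msqrt D ** minvsqrt M ** (msqrt D ** C ** msqrt D) ** minvsqrt M ** msqrt D"
    by (simp only: X matrix_mul_assoc)
  also have "\<dots> = msqrt D ** minvsqrt M ** (msqrt M ** msqrt M) ** minvsqrt M ** msqrt D"
    by (simp only: M_def[symmetric] msqrt_mult_msqrt[OF M])
  also have "\<dots> = msqrt D ** (minvsqrt M ** msqrt M) ** (msqrt M ** minvsqrt M) ** msqrt D"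
    by (simp only: matrix_mul_assoc)
  finally show "X ** C ** X = D"
    by (simp add: minvsqrt_mult_msqrt msqrt_mult_minvsqrt M msqrt_mult_msqrt D)
qed

section \<open>Descent\<close>

text \<open>Up to the factor -2, the Riemannian gradient of \<open>F\<close> at \<open>X\<close>,
  whitened to the identity.\<close>

definition log_gradient :: "nat \<Rightarrow> (nat \<Rightarrow> real ^ 'p ^ 'p) \<Rightarrow> real ^ 'p ^ 'p \<Rightarrow> real ^ 'p ^ 'p" where
  "log_gradient n A X = (\<Sum>i=1..n. mlog (minvsqrt X ** A i ** minvsqrt X))"

lemma transpose_log_gradient:
  assumes "X \<in> spd" "\<And>i. i \<in> {1..n} \<Longrightarrow> A i \<in> spd"
  shows "transpose (log_gradient n A X) = log_gradient n A X"
  unfolding log_gradient_def transpose_sum mlog_def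
  by (intro sum.cong refl matfun_symmetric spdD minvsqrt_conj_in_spd assms)

text \<open>After whitening by \<open>X0\<close>, the metric increasing property bounds each
  distance below by a Euclidean one, with equality at \<open>X0\<close>. Expanding the Euclidean
  squares gives the quadratic bound.\<close>

lemma F_strongly_convex:
  assumes X0: "X0 \<in> spd" and X: "X \<in> spd" and A: "\<And>i. i \<in> {1..n} \<Longrightarrow> A i \<in> spd"
  defines "V \<equiv> mlog (minvsqrt X0 ** X ** minvsqrt X0)"
  shows "F n A X \<ge> F n A X0 - 2 * (V \<bullet> log_gradient n A X0) + n * (norm V)\<^sup>2"
proof -
  have "(spd_dist (A i) X)\<^sup>2 \<ge> (spd_dist (A i) X0)\<^sup>2 - 2 * (V \<bullet> mlog (minvsqrt X0 ** A i ** minvsqrt X0)) + (norm V)\<^sup>2"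
    if i: "i \<in> {1..n}" for i
  proof -
    let ?B = "minvsqrt X0 ** A i ** minvsqrt X0"
    have "norm (V - mlog ?B) \<le> spd_dist (A i) X"
      using norm_mlog_diff_le_spd_dist[of "minvsqrt X0 ** X ** minvsqrt X0" ?B] A[OF i] X X0
      by (simp add: V_def minvsqrt_conj_in_spd spd_dist_minvsqrt_conj)
    then have "(norm (V - mlog ?B))\<^sup>2 \<le> (spd_dist (A i) X)\<^sup>2" by (intro power_mono) auto
    then show ?thesis
      by (simp add: power2_norm_eq_inner inner_diff_left inner_diff_right inner_commute spd_dist_def)
  qed
  then have "F n A X \<ge> (\<Sum>i=1..n. (spd_dist (A i) X0)\<^sup>2 - 2 * (V \<bullet> mlog (minvsqrt X0 ** A i ** minvsqrt X0)) + (norm V)\<^sup>2)"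
    unfolding F_def by (intro sum_mono)
  then show ?thesis
    by (simp add: F_def log_gradient_def inner_sum_right sum.distrib sum_subtractf sum_distrib_left)
qed

lemma F_gap_le_log_gradient:
  assumes n: "n \<ge> 1" and X0: "X0 \<in> spd" and X: "X \<in> spd" and A: "\<And>i. i \<in> {1..n} \<Longrightarrow> A i \<in> spd"
  shows "F n A X0 - F n A X \<le> (norm (log_gradient n A X0))\<^sup>2 / n"
proof -
  define S V where "S = log_gradient n A X0" and "V = mlog (minvsqrt X0 ** X ** minvsqrt X0)"
  \<comment> \<open>The quadratic lower bound is smallest at \<open>V = S / n\<close>; this square
    is the excess over that minimum.\<close>
  have "0 \<le> (norm (real n *\<^sub>R V - S))\<^sup>2 / n" by simp
  also have "(norm (real n *\<^sub>R V - S))\<^sup>2 = (real n)\<^sup>2 * (norm V)\<^sup>2 - 2 * n * (V \<bullet> S) + (norm S)\<^sup>2"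
    unfolding power2_norm_eq_inner
    by (simp add: inner_diff_left inner_diff_right inner_commute power2_eq_square algebra_simps)
  also have "\<dots> / n = n * (norm V)\<^sup>2 - 2 * (V \<bullet> S) + (norm S)\<^sup>2 / n"
    using n by (simp add: field_simps power2_eq_square)
  finally show ?thesis
    using F_strongly_convex[where n = n and A = A, OF X0 X A] unfolding S_def V_def by simp
qed

lemma exp_le_quadratic:
  fixes v :: real
  assumes "\<bar>v\<bar> \<le> 1"
  shows "exp v \<le> 1 + v + v\<^sup>2"
proof (cases "v \<ge> 0")
  case True
  then show ?thesis using assms exp_bound[of v] by simp
next
  case False
  \<comment> \<open>For negative \<open>v\<close>, comparing both sides after multiplication by the
    positive number \<open>1 - v\<close> suffices.\<close>
  have "exp v * (1 - v) \<le> exp v * exp (- v)"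
    using exp_ge_add_one_self[of "- v"] by (intro mult_left_mono) auto
  also have "\<dots> = 1" by (simp flip: exp_add)
  also have "1 \<le> (1 + v + v\<^sup>2) * (1 - v)"
  proof -
    have "(1 + v + v\<^sup>2) * (1 - v) = 1 - v * v\<^sup>2" by (simp add: algebra_simps power2_eq_square)
    moreover have "v * v\<^sup>2 \<le> 0" using False by (simp add: mult_nonpos_nonneg)
    ultimately show ?thesis by simp
  qed
  finally show ?thesis using False by simp
qed

text \<open>Second-order expansion of the majorizer along \<open>exp (e S)\<close>. With
  \<open>l = ln b\<close>, the constant term is \<open>k1 + k2 - k0 = l^2\<close>, the slope is
  \<open>k1 - k2 = -2 l\<close>, and the quadratic coefficient
  \<open>k1 + k2 = 2 sqrt (l^2 + 1)\<close> is at most \<open>2 (R + 1)\<close>.\<close>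

lemma majorizer_exp_le:
  fixes B S :: "real ^ 'p ^ 'p"
  assumes B: "B \<in> spd" and S: "transpose S = S" and R: "norm (mlog B) \<le> R"
    and e: "0 \<le> e" "e * norm S \<le> 1"
  shows "matfun k1 B \<bullet> matfun (\<lambda>s. exp (e * s)) S + matfun k2 B \<bullet> matfun (\<lambda>s. exp (- (e * s))) S - matfun k0 B \<bullet> mat 1
    \<le> (norm (mlog B))\<^sup>2 - 2 * e * (mlog B \<bullet> S) + 2 * (R + 1) * e\<^sup>2 * (norm S)\<^sup>2"
proof -
  note sB = spdD(1)[OF B]
  obtain w b s where js: "joint_spectrum B S w b s"
    using joint_spectrum_exists[OF sB S] .
  note w = joint_spectrumD(1)[OF js] and tr = joint_spectrumD(4)[OF js]
  have scalar: "k1 (b i) * exp (e * s j) + k2 (b i) * exp (- (e * s j)) - k0 (b i)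
      \<le> (ln (b i))\<^sup>2 - 2 * e * (ln (b i) * s j) + 2 * (R + 1) * e\<^sup>2 * (s j)\<^sup>2" for i j
  proof -
    define v l where "v = e * s j" and "l = ln (b i)"
    have "\<bar>s j\<bar> \<le> norm S"
      using norm_matfun_eigenvalues(2)[OF js sB S, of "\<lambda>x. x" j] by (simp add: matfun_id S)
    then have "e * \<bar>s j\<bar> \<le> e * norm S" using e by (intro mult_left_mono) auto
    then have v: "\<bar>v\<bar> \<le> 1" using e by (simp add: v_def abs_mult)
    have l: "\<bar>l\<bar> \<le> R"
      using norm_matfun_eigenvalues(1)[OF js sB S, of ln i] R by (simp add: l_def mlog_def)
    have "sqrt (l\<^sup>2 + 1) \<le> \<bar>l\<bar> + 1"
      by (rule real_le_lsqrt) (auto simp: power2_eq_square algebra_simps)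
    then have "2 * sqrt (l\<^sup>2 + 1) * v\<^sup>2 \<le> 2 * (R + 1) * v\<^sup>2"
      using l by (intro mult_right_mono) auto
    moreover have "k1 (b i) * exp v \<le> k1 (b i) * (1 + v + v\<^sup>2)"
      using v k1_pos by (intro mult_left_mono exp_le_quadratic) (auto intro: less_imp_le)
    moreover have "k2 (b i) * exp (- v) \<le> k2 (b i) * (1 + (- v) + (- v)\<^sup>2)"
      using v k2_pos by (intro mult_left_mono exp_le_quadratic) (auto intro: less_imp_le)
    ultimately have "k1 (b i) * exp v + k2 (b i) * exp (- v) - k0 (b i) \<le> l\<^sup>2 - 2 * (l * v) + 2 * (R + 1) * v\<^sup>2"
      by (simp add: k1_def k2_def k0_def l_def[symmetric] algebra_simps)
    then show ?thesis by (simp add: v_def l_def power_mult_distrib mult_ac)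
  qed
  have "matfun k1 B \<bullet> matfun (\<lambda>s. exp (e * s)) S + matfun k2 B \<bullet> matfun (\<lambda>s. exp (- (e * s))) S
      - matfun k0 B \<bullet> matfun (\<lambda>_. 1) S
    = (\<Sum>i\<in>UNIV. \<Sum>j\<in>UNIV. w i j * (k1 (b i) * exp (e * s j) + k2 (b i) * exp (- (e * s j)) - k0 (b i)))"
    unfolding tr by (simp add: sum.distrib sum_subtractf distrib_left right_diff_distrib)
  also have "\<dots> \<le> (\<Sum>i\<in>UNIV. \<Sum>j\<in>UNIV. w i j * ((ln (b i))\<^sup>2 - 2 * e * (ln (b i) * s j) + 2 * (R + 1) * e\<^sup>2 * (s j)\<^sup>2))"
    by (intro sum_mono mult_left_mono w scalar)
  also have "\<dots> = matfun (\<lambda>b. (ln b)\<^sup>2) B \<bullet> matfun (\<lambda>_. 1) S - 2 * e * (matfun ln B \<bullet> matfun (\<lambda>s. s) S)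
      + 2 * (R + 1) * e\<^sup>2 * (matfun (\<lambda>_. 1) B \<bullet> matfun (\<lambda>s. s\<^sup>2) S)"
    unfolding tr by (simp add: sum.distrib sum_subtractf distrib_left right_diff_distrib sum_distrib_left mult_ac)
  also have "matfun (\<lambda>b. (ln b)\<^sup>2) B \<bullet> matfun (\<lambda>_. 1) S = (norm (mlog B))\<^sup>2"
    by (simp add: mlog_def norm_matfun_power2 sB S matfun_const)
  also have "matfun (\<lambda>_. 1) B \<bullet> matfun (\<lambda>s. s\<^sup>2) S = (norm S)\<^sup>2"
    using norm_matfun_power2[OF S, of "\<lambda>s. s"] by (simp add: sB S matfun_const matfun_id inner_commute)
  finally show ?thesis by (simp add: mlog_def matfun_id matfun_const S)
qed

lemma f_in_spd:
  assumes n: "n \<ge> 1" and X: "X \<in> spd" and A: "\<And>i. i \<in> {1..n} \<Longrightarrow> A i \<in> spd"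
  shows "f1 n A X \<in> spd" "f2 n A X \<in> spd"
proof -
  have B: "minvsqrt X ** A i ** minvsqrt X \<in> spd" if "i \<in> {1..n}" for i
    using minvsqrt_conj_in_spd X A[OF that] by blast
  have "f1 n A X = minvsqrt X ** (\<Sum>i=1..n. matfun k1 (minvsqrt X ** A i ** minvsqrt X)) ** minvsqrt X"
    by (simp only: f1_conj[OF X A, symmetric] minvsqrt_msqrt_conj[OF X])
  also have "\<dots> \<in> spd"
    using n by (intro minvsqrt_conj_in_spd X sum_in_spd matfun_in_spd[OF B] k1_pos) auto
  finally show "f1 n A X \<in> spd" .
  have "f2 n A X = msqrt X ** (\<Sum>i=1..n. matfun k2 (minvsqrt X ** A i ** minvsqrt X)) ** msqrt X"
    by (simp only: f2_conj[OF X A, symmetric] msqrt_minvsqrt_conj[OF X])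
  also have "\<dots> \<in> spd"
    using n by (intro msqrt_conj_in_spd X sum_in_spd matfun_in_spd[OF B] k2_pos) auto
  finally show "f2 n A X \<in> spd" .
qed

lemma T_in_spd:
  assumes "n \<ge> 1" "X \<in> spd" "\<And>i. i \<in> {1..n} \<Longrightarrow> A i \<in> spd"
  shows "T n A X \<in> spd"
  unfolding T_def by (intro riccati_solution(1) f_in_spd assms)

text \<open>Here \<open>Y\<close> is a competitor in coordinates whitened by \<open>X\<close>. The
  Riccati equation for \<open>T\<close> becomes \<open>Z D1 Z = D2\<close>, which makes the whitened
  update \<open>Z\<close> a minimizer of the majorizer.\<close>

lemma F_T_le_majorizer:
  assumes n: "n \<ge> 1" and X: "X \<in> spd" and A: "\<And>i. i \<in> {1..n} \<Longrightarrow> A i \<in> spd" and Y: "Y \<in> spd"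
  defines "B \<equiv> \<lambda>i. minvsqrt X ** A i ** minvsqrt X"
  shows "F n A (T n A X) \<le> (\<Sum>i=1..n. matfun k1 (B i) \<bullet> Y + matfun k2 (B i) \<bullet> matfun inverse Y - matfun k0 (B i) \<bullet> mat 1)"
proof -
  define D1 D2 where "D1 = (\<Sum>i=1..n. matfun k1 (B i))" and "D2 = (\<Sum>i=1..n. matfun k2 (B i))"
  define Z where "Z = minvsqrt X ** T n A X ** minvsqrt X"
  note TX = T_in_spd[OF n X A]
  have Z: "Z \<in> spd" unfolding Z_def by (rule minvsqrt_conj_in_spd[OF X TX])
  have B: "B i \<in> spd" if "i \<in> {1..n}" for i
    unfolding B_def using minvsqrt_conj_in_spd X A[OF that] by blast
  have D1: "D1 \<in> spd"
    unfolding D1_def using n by (intro sum_in_spd matfun_in_spd[OF B] k1_pos) auto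
  have "Z ** D1 ** Z = minvsqrt X ** T n A X ** (minvsqrt X ** (msqrt X ** f1 n A X ** msqrt X) ** minvsqrt X) ** T n A X ** minvsqrt X"
    by (simp only: Z_def D1_def B_def f1_conj[OF X A] matrix_mul_assoc)
  also have "\<dots> = minvsqrt X ** (T n A X ** f1 n A X ** T n A X) ** minvsqrt X"
    by (simp only: minvsqrt_msqrt_conj[OF X]) (simp only: matrix_mul_assoc)
  also have "T n A X ** f1 n A X ** T n A X = f2 n A X"
    unfolding T_def by (intro riccati_solution(2) f_in_spd n X A)
  finally have ZDZ: "Z ** D1 ** Z = D2"
    by (simp only: f2_conj[OF X A] D2_def B_def)
  have "F n A (T n A X) = (\<Sum>i=1..n. (spd_dist (B i) Z)\<^sup>2)"
    unfolding F_def B_def Z_def by (intro sum.cong refl) (simp only: spd_dist_minvsqrt_conj[OF TX A X])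
  also have "\<dots> \<le> (\<Sum>i=1..n. matfun k1 (B i) \<bullet> Z + matfun k2 (B i) \<bullet> matfun inverse Z - matfun k0 (B i) \<bullet> mat 1)"
    by (intro sum_mono spd_dist_power2_le_majorizer B Z)
  also have "\<dots> = D1 \<bullet> Z + D2 \<bullet> matfun inverse Z - (\<Sum>i=1..n. matfun k0 (B i) \<bullet> mat 1)"
    by (simp add: D1_def D2_def inner_sum_left sum.distrib sum_subtractf)
  also have "\<dots> \<le> D1 \<bullet> Y + D2 \<bullet> matfun inverse Y - (\<Sum>i=1..n. matfun k0 (B i) \<bullet> mat 1)"
    using trace_majorizer_minimum[OF D1 Z Y] by (simp add: ZDZ)
  also have "\<dots> = (\<Sum>i=1..n. matfun k1 (B i) \<bullet> Y + matfun k2 (B i) \<bullet> matfun inverse Y - matfun k0 (B i) \<bullet> mat 1)"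
    by (simp add: D1_def D2_def inner_sum_left sum.distrib sum_subtractf)
  finally show ?thesis .
qed

text \<open>Compare with the point reached from \<open>X\<close> by the geodesic step \<open>S / (2 n (R + 1))\<close>, \<open>S\<close> the log-gradient.\<close>

lemma F_T_descent:
  assumes n: "n \<ge> 1" and X: "X \<in> spd" and A: "\<And>i. i \<in> {1..n} \<Longrightarrow> A i \<in> spd"
    and R: "\<And>i. i \<in> {1..n} \<Longrightarrow> spd_dist (A i) X \<le> R"
  shows "F n A (T n A X) \<le> F n A X - (norm (log_gradient n A X))\<^sup>2 / (2 * real n * (R + 1))"
proof -
  define B where "B = (\<lambda>i. minvsqrt X ** A i ** minvsqrt X)"
  define S where "S = log_gradient n A X"
  \<comment> \<open>The minimizer of \<open>-2 e + 2 n (R + 1) e^2\<close>, the coefficient of the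
    squared norm of \<open>S\<close> in the majorizer bound.\<close>
  define e where "e = 1 / (2 * real n * (R + 1))"
  have dist: "spd_dist (A i) X = norm (mlog (B i))" for i by (simp add: B_def spd_dist_def)
  have B: "B i \<in> spd" if "i \<in> {1..n}" for i
    unfolding B_def using minvsqrt_conj_in_spd X A[OF that] by blast
  have sS: "transpose S = S" unfolding S_def by (rule transpose_log_gradient[OF X A])
  have R0: "0 \<le> R" using R[of 1] n by (simp add: dist order_trans[OF norm_ge_zero])
  have e: "e \<ge> 0" using R0 by (simp add: e_def)
  \<comment> \<open>The same choice of \<open>e\<close> keeps every exponent in
    \<open>[-1, 1]\<close>, where the quadratic bound on \<open>exp\<close> holds.\<close>
  have "norm S \<le> (\<Sum>i=1..n. R)"
    unfolding S_def log_gradient_def by (rule sum_norm_le) (use R in \<open>simp add: dist B_def\<close>)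
  also have "\<dots> \<le> 2 * real n * (R + 1)"
    using mult_nonneg_nonneg[OF of_nat_0_le_iff R0, of n] by (simp add: algebra_simps)
  finally have "e * norm S \<le> e * (2 * real n * (R + 1))"
    using e by (intro mult_left_mono)
  also have "\<dots> = 1" using n R0 by (simp add: e_def)
  finally have eS: "e * norm S \<le> 1" .
  define Y where "Y = matfun (\<lambda>s. exp (e * s)) S"
  have Y: "Y \<in> spd" unfolding Y_def by (rule matfun_symmetric_in_spd[OF sS]) simp
  have Yi: "matfun inverse Y = matfun (\<lambda>s. exp (- (e * s))) S"
    unfolding Y_def by (simp add: matfun_comp sS exp_minus)
  have "F n A (T n A X) \<le> (\<Sum>i=1..n. matfun k1 (B i) \<bullet> Y + matfun k2 (B i) \<bullet> matfun inverse Y - matfun k0 (B i) \<bullet> mat 1)"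
    using F_T_le_majorizer[OF n X A Y] by (simp add: B_def)
  also have "\<dots> \<le> (\<Sum>i=1..n. (norm (mlog (B i)))\<^sup>2 - 2 * e * (mlog (B i) \<bullet> S) + 2 * (R + 1) * e\<^sup>2 * (norm S)\<^sup>2)"
    unfolding Yi unfolding Y_def
    by (intro sum_mono majorizer_exp_le B sS e eS) (use R in \<open>auto simp: dist\<close>)
  also have "\<dots> = F n A X - 2 * e * (S \<bullet> S) + n * (2 * (R + 1) * e\<^sup>2 * (norm S)\<^sup>2)"
  proof -
    have "(\<Sum>i=1..n. mlog (B i) \<bullet> S) = S \<bullet> S"
      by (simp add: S_def log_gradient_def B_def flip: inner_sum_left)
    then show ?thesis
      by (simp add: F_def dist sum.distrib sum_subtractf flip: sum_distrib_left)
  qed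
  also have "\<dots> = F n A X - 2 * e * (norm S)\<^sup>2 + (2 * real n * (R + 1) * e) * e * (norm S)\<^sup>2"
    by (simp add: power2_norm_eq_inner) (simp add: power2_eq_square algebra_simps)
  also have "2 * real n * (R + 1) * e = 1" using n R0 by (simp add: e_def)
  also have "F n A X - 2 * e * (norm S)\<^sup>2 + 1 * e * (norm S)\<^sup>2 = F n A X - (norm S)\<^sup>2 / (2 * real n * (R + 1))"
    by (simp add: e_def)
  finally show ?thesis by (simp add: S_def)
qed

section \<open>The Karcher mean\<close>

lemma spd_dist_le_sqrt_F:
  assumes "i \<in> {1..n}"
  shows "spd_dist (A i) X \<le> sqrt (F n A X)"
  unfolding F_def using assms by (intro real_le_rsqrt member_le_sum) auto

lemma matfun_exp_mlog:
  assumes "X \<in> spd"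
  shows "matfun exp (mlog X) = X"
proof -
  have "matfun exp (mlog X) = matfun (\<lambda>x. x) X"
    unfolding mlog_def matfun_comp[OF spdD(1)[OF assms]] by (rule matfun_cong[OF assms]) simp
  then show ?thesis by (simp add: matfun_id spdD[OF assms])
qed

text \<open>Logarithmic coordinates replace the open cone \<open>spd\<close> by the closed linear
  space of symmetric matrices, where bounded closed sets are compact.\<close>

lemma continuous_on_F_exp:
  fixes A :: "nat \<Rightarrow> real ^ 'p ^ 'p"
  assumes A: "\<And>i. i \<in> {1..n} \<Longrightarrow> A i \<in> spd"
  shows "continuous_on {H. transpose H = H} (\<lambda>H. F n A (matfun exp H))"
proof -
  let ?Sym = "{H :: real ^ 'p ^ 'p. transpose H = H}"
  have E: "matfun exp H \<in> spd" if "H \<in> ?Sym" for H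
    using that by (intro matfun_symmetric_in_spd) auto
  have "continuous_on ?Sym (\<lambda>H. spd_dist (A i) (matfun exp H))" if i: "i \<in> {1..n}" for i
  proof -
    have "continuous_on ?Sym (\<lambda>H. matfun (\<lambda>x. 1 / sqrt (exp x)) H)"
      by (rule continuous_on_matfun_symmetric) (auto intro!: continuous_intros)
    also have "?this \<longleftrightarrow> continuous_on ?Sym (\<lambda>H. minvsqrt (matfun exp H))"
      by (rule continuous_on_cong) (auto simp: minvsqrt_def matfun_comp)
    finally have N: "continuous_on ?Sym (\<lambda>H. minvsqrt (matfun exp H) ** A i ** minvsqrt (matfun exp H))"
      by (intro matmul.continuous_on continuous_on_const)
    have log: "continuous_on (spd :: (real ^ 'p ^ 'p) set) mlog"
      unfolding mlog_def by (rule continuous_on_matfun_spd) (auto intro!: continuous_intros)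
    have N_spd: "minvsqrt (matfun exp H) ** A i ** minvsqrt (matfun exp H) \<in> spd" if "H \<in> ?Sym" for H
      by (rule minvsqrt_conj_in_spd[OF E[OF that] A[OF i]])
    have "continuous_on ?Sym (\<lambda>H. mlog (minvsqrt (matfun exp H) ** A i ** minvsqrt (matfun exp H)))"
      by (rule continuous_on_compose2[OF log N]) (use N_spd in blast)
    then show ?thesis unfolding spd_dist_def by (rule continuous_on_norm)
  qed
  then show ?thesis unfolding F_def by (intro continuous_on_sum continuous_on_power)
qed

text \<open>By the metric increasing property, the sublevel set of \<open>F\<close> through
  \<open>A 1\<close> lies, in logarithmic coordinates, in the compact set \<open>K\<close>. A
  minimizer over \<open>K\<close> is global, since points outside that sublevel set are worse than
  \<open>A 1\<close>.\<close>

lemma karcher_mean_minimizes: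
  fixes A :: "nat \<Rightarrow> real ^ 'p ^ 'p"
  assumes n: "n \<ge> 1" and A: "\<And>i. i \<in> {1..n} \<Longrightarrow> A i \<in> spd"
  shows "karcher_mean n A \<in> spd" "X \<in> spd \<Longrightarrow> F n A (karcher_mean n A) \<le> F n A X"
proof -
  have 1: "1 \<in> {1..n}" using n by simp
  define r where "r = sqrt (F n A (A 1))"
  define K where "K = {H :: real ^ 'p ^ 'p. transpose H = H} \<inter> cball (mlog (A 1)) r"
  have "closed {H :: real ^ 'p ^ 'p. transpose H = H}"
  proof (rule closed_Collect_eq)
    have "bounded_linear (transpose :: real ^ 'p ^ 'p \<Rightarrow> _)"
      by (auto intro!: linear_conv_bounded_linear[THEN iffD1] linearI simp: transpose_add transpose_scalar)
    then show "continuous_on UNIV (transpose :: real ^ 'p ^ 'p \<Rightarrow> _)"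
      by (simp add: linear_continuous_on)
  qed simp
  then have "compact K" unfolding K_def by (simp add: closed_Int_compact)
  moreover have K: "mlog X \<in> K" if X: "X \<in> spd" and le: "F n A X \<le> F n A (A 1)" for X
  proof -
    have "norm (mlog X - mlog (A 1)) \<le> spd_dist (A 1) X"
      by (rule norm_mlog_diff_le_spd_dist[OF X A[OF 1]])
    also have "\<dots> \<le> sqrt (F n A X)" by (rule spd_dist_le_sqrt_F[OF 1])
    also have "\<dots> \<le> r" unfolding r_def using le by simp
    finally show ?thesis
      unfolding K_def mlog_def by (auto simp: matfun_symmetric spdD[OF X] dist_norm norm_minus_commute)
  qed
  then have "K \<noteq> {}" using A[OF 1] by blast
  moreover have "continuous_on K (\<lambda>H. F n A (matfun exp H))"
    by (rule continuous_on_subset[OF continuous_on_F_exp[OF A]]) (auto simp: K_def)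
  ultimately obtain H where H: "H \<in> K" and min: "\<And>G. G \<in> K \<Longrightarrow> F n A (matfun exp H) \<le> F n A (matfun exp G)"
    using continuous_attains_inf[of K "\<lambda>H. F n A (matfun exp H)"] by blast
  have min': "F n A (matfun exp H) \<le> F n A X" if X: "X \<in> spd" for X
  proof (cases "F n A X \<le> F n A (A 1)")
    case True
    from min[OF K[OF X this]] show ?thesis by (simp add: matfun_exp_mlog X)
  next
    case False
    have "F n A (matfun exp H) \<le> F n A (A 1)"
      using min[OF K[OF A[OF 1] order_refl]] by (simp only: matfun_exp_mlog[OF A[OF 1]])
    with False show ?thesis by simp
  qed
  have "matfun exp H \<in> spd" using H by (intro matfun_symmetric_in_spd) (auto simp: K_def)
  then have "is_arg_min (F n A) (\<lambda>X. X \<in> spd) (matfun exp H)"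
    using min' by (force simp: is_arg_min_def)
  \<comment> \<open>A minimizer exists, so the one chosen by \<open>arg_min\<close> is itself a
    minimizer.\<close>
  then have "is_arg_min (F n A) (\<lambda>X. X \<in> spd) (karcher_mean n A)"
    unfolding karcher_mean_def arg_min_def by (rule someI)
  then show "karcher_mean n A \<in> spd" "X \<in> spd \<Longrightarrow> F n A (karcher_mean n A) \<le> F n A X"
    by (auto simp: is_arg_min_def not_less)
qed

text \<open>A nonzero log-gradient would make one step of \<open>T\<close> decrease \<open>F\<close>
  strictly below its minimum.\<close>

lemma log_gradient_karcher_mean:
  assumes n: "n \<ge> 1" and A: "\<And>i. i \<in> {1..n} \<Longrightarrow> A i \<in> spd"
  shows "log_gradient n A (karcher_mean n A) = 0"
proof -
  let ?X = "karcher_mean n A"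
  note X = karcher_mean_minimizes(1)[OF n A]
  define R where "R = sqrt (F n A ?X)"
  have "F n A (T n A ?X) \<le> F n A ?X - (norm (log_gradient n A ?X))\<^sup>2 / (2 * real n * (R + 1))"
    by (rule F_T_descent[OF n X A]) (simp_all only: R_def spd_dist_le_sqrt_F)
  moreover have "F n A ?X \<le> F n A (T n A ?X)"
    by (intro karcher_mean_minimizes n A T_in_spd X)
  ultimately have "(norm (log_gradient n A ?X))\<^sup>2 / (2 * real n * (R + 1)) \<le> 0" by simp
  moreover have "2 * real n * (R + 1) > 0"
    using n by (auto simp: R_def F_def sum_nonneg intro!: mult_pos_pos add_nonneg_pos)
  ultimately have "(norm (log_gradient n A ?X))\<^sup>2 \<le> 0" by (simp add: divide_le_0_iff)
  then show ?thesis by simp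
qed

section \<open>Convergence of the iteration and its linear rate\<close>

theorem theorem3p1:
  fixes n :: nat
    and A :: "nat \<Rightarrow> real ^ 'p ^ 'p"
    and X :: "nat \<Rightarrow> real ^ 'p ^ 'p"
  assumes "n \<ge> 1"
    and "\<And>i. i \<in> {1..n} \<Longrightarrow> A i \<in> spd"
    and "X 1 \<in> spd"
    and "\<And>k. k \<ge> 1 \<Longrightarrow> X (Suc k) = T n A (X k)"
  shows "X \<longlonglongrightarrow> karcher_mean n A \<and>
         (\<exists>(K::nat) (q::real). 0 \<le> q \<and> q < 1 \<and>
           (\<forall>k>K. F n A (X (Suc k)) - F n A (karcher_mean n A)
                    \<le> q * (F n A (X k) - F n A (karcher_mean n A))))"
proof -
  note n = assms(1) and A = assms(2)
  define M where "M = karcher_mean n A"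
  have M: "M \<in> spd" unfolding M_def by (intro karcher_mean_minimizes n A)
  \<comment> \<open>One bound on the distances to all \<open>A i\<close>, valid throughout the
    sublevel set of \<open>X 1\<close>.\<close>
  define R where "R = sqrt (F n A (X 1))"
  have R0: "R \<ge> 0" by (simp add: R_def F_def sum_nonneg)
  have X: "X k \<in> spd" if "k \<ge> 1" for k
    using that
  proof (induction k rule: dec_induct)
    case (step k)
    then show ?case using assms(4)[of k] T_in_spd[OF n step.IH A] by simp
  qed (use assms(3) in simp)
  have descent: "F n A (X (Suc k)) \<le> F n A (X k) - (norm (log_gradient n A (X k)))\<^sup>2 / (2 * real n * (R + 1))"
    if "k \<ge> 1" and le: "F n A (X k) \<le> F n A (X 1)" for k
  proof -
    have "spd_dist (A i) (X k) \<le> R" if "i \<in> {1..n}" for i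
      unfolding R_def by (rule order_trans[OF spd_dist_le_sqrt_F[OF that] real_sqrt_le_mono[OF le]])
    from F_T_descent[OF n X[OF that(1)] A this] show ?thesis
      using assms(4)[OF that(1)] by simp
  qed
  \<comment> \<open>The descent estimate presupposes membership in this sublevel set, and in turn
    keeps the next iterate there.\<close>
  have bounded: "F n A (X k) \<le> F n A (X 1)" if "k \<ge> 1" for k
    using that
  proof (induction k rule: dec_induct)
    case (step k)
    have "0 \<le> (norm (log_gradient n A (X k)))\<^sup>2 / (2 * real n * (R + 1))" using R0 by simp
    with descent[of k] step show ?case by linarith
  qed simp
  \<comment> \<open>The gap is at most the squared gradient norm over \<open>n\<close>, so each
    descent removes at least the fraction \<open>1 / (2 (R + 1))\<close> of it.\<close>
  define q where "q = 1 - 1 / (2 * (R + 1))"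
  have q: "0 \<le> q" "q < 1" using R0 by (auto simp: q_def field_simps)
  define a where "a = (\<lambda>k. F n A (X k) - F n A M)"
  have linear: "a (Suc k) \<le> q * a k" if k: "k \<ge> 1" for k
  proof -
    have "a k \<le> (norm (log_gradient n A (X k)))\<^sup>2 / n"
      unfolding a_def by (intro F_gap_le_log_gradient n X[OF k] M A)
    then have "a k / (2 * (R + 1)) \<le> (norm (log_gradient n A (X k)))\<^sup>2 / n / (2 * (R + 1))"
      using R0 by (intro divide_right_mono) auto
    also have "\<dots> = (norm (log_gradient n A (X k)))\<^sup>2 / (2 * real n * (R + 1))"
      by (simp add: mult_ac)
    finally show ?thesis
      using descent[OF k bounded[OF k]] by (simp add: a_def q_def left_diff_distrib)
  qed
  \<comment> \<open>Powers count steps from \<open>X 1\<close>; the recursion leaves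
    \<open>X 0\<close> arbitrary.\<close>
  have geometric: "a (Suc k) \<le> q ^ k * a 1" for k
  proof (induction k)
    case (Suc k)
    have "a (Suc (Suc k)) \<le> q * a (Suc k)" by (rule linear) simp
    also have "\<dots> \<le> q * (q ^ k * a 1)" using Suc q by (intro mult_left_mono)
    finally show ?case by simp
  qed simp
  define V where "V = (\<lambda>k. mlog (minvsqrt M ** X k ** minvsqrt M))"
  \<comment> \<open>At \<open>M\<close> the linear term of the strong convexity bound
    vanishes.\<close>
  have Vbound: "n * (norm (V k))\<^sup>2 \<le> a k" if "k \<ge> 1" for k
    using F_strongly_convex[where n = n and A = A, OF M X[OF that] A] log_gradient_karcher_mean[OF n A]
    by (simp add: a_def V_def M_def)
  have lim: "(\<lambda>k. q ^ k * a 1) \<longlonglongrightarrow> 0"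
    using q by (intro tendsto_mult_left_zero LIMSEQ_realpow_zero) auto
  have "(\<lambda>k. (norm (V (Suc k)))\<^sup>2) \<longlonglongrightarrow> 0"
  proof (rule tendsto_sandwich[OF _ _ tendsto_const lim])
    show "\<forall>\<^sub>F k in sequentially. (norm (V (Suc k)))\<^sup>2 \<le> q ^ k * a 1"
    proof (intro always_eventually allI)
      fix k
      have "(norm (V (Suc k)))\<^sup>2 \<le> n * (norm (V (Suc k)))\<^sup>2"
        using n by (simp add: mult_le_cancel_right1)
      also have "\<dots> \<le> a (Suc k)" by (rule Vbound) simp
      finally show "(norm (V (Suc k)))\<^sup>2 \<le> q ^ k * a 1" using geometric[of k] by linarith
    qed
  qed simp
  then have "(\<lambda>k. sqrt ((norm (V (Suc k)))\<^sup>2)) \<longlonglongrightarrow> sqrt 0" by (rule tendsto_real_sqrt)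
  then have V0: "(\<lambda>k. V (Suc k)) \<longlonglongrightarrow> 0" by (simp add: tendsto_norm_zero_iff)
  have Y: "minvsqrt M ** X (Suc k) ** minvsqrt M \<in> spd" for k
    by (intro minvsqrt_conj_in_spd M X) simp
  have "transpose (0 :: real ^ 'p ^ 'p) = 0" by (simp add: transpose_def vec_eq_iff)
  moreover have "transpose (V (Suc k)) = V (Suc k)" for k
    unfolding V_def mlog_def by (rule matfun_symmetric[OF spdD(1)[OF Y]])
  \<comment> \<open>Continuity of the matrix exponential at 0 carries convergence of the logarithms
    back to the whitened iterates.\<close>
  ultimately have "(\<lambda>k. matfun exp (V (Suc k))) \<longlonglongrightarrow> matfun exp 0"
    by (intro continuous_on_tendsto_compose[OF continuous_on_matfun_symmetric V0] isCont_exp)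
      simp_all
  then have "(\<lambda>k. minvsqrt M ** X (Suc k) ** minvsqrt M) \<longlonglongrightarrow> mat 1"
    by (simp add: V_def matfun_exp_mlog Y matfun_zero)
  then have "(\<lambda>k. msqrt M ** (minvsqrt M ** X (Suc k) ** minvsqrt M) ** msqrt M) \<longlonglongrightarrow> msqrt M ** mat 1 ** msqrt M"
    by (intro matmul.tendsto tendsto_const)
  then have "(\<lambda>k. X (Suc k)) \<longlonglongrightarrow> M"
    by (simp only: msqrt_minvsqrt_conj[OF M] matrix_mul_rid msqrt_mult_msqrt[OF M])
  then have "X \<longlonglongrightarrow> M" by (rule LIMSEQ_imp_Suc)
  \<comment> \<open>The contraction holds from index 1 on, so \<open>K = 0\<close> is the
    witness.\<close>
  moreover have "\<forall>k>0. F n A (X (Suc k)) - F n A M \<le> q * (F n A (X k) - F n A M)"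
    using linear by (simp add: a_def)
  ultimately show ?thesis using q unfolding M_def by blast
qed

end
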